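(* Let $d\ge2$ and let $u\in\dot{\mathrm{BV}}(\mathbb{R}^d)$. For every $\epsilon>0$ there exists $\delta>0$ such that $|Du|(B)<\epsilon$ whenever $B\subset\mathbb{R}^d$ is a Borel set with $\mathcal{H}^{d-1}(B)<\delta$.
   Context: $\dot{\mathrm{BV}}(\mathbb{R}^d)$ is the space of $u\in L^1_{loc}(\mathbb{R}^d)$ whose distributional gradient $Du$ is a finite $\mathbb{R}^d$-valued Radon measure on $\mathbb{R}^d$; $|Du|$ is the total variation measure of $Du$. $\mathcal{H}^{d-1}$ is the $(d-1)$-dimensional Hausdorff measure. *)

theory Defs
  imports "HOL-Analysis.Analysis"
begin

definition locally_integrable :: "('a::euclidean_space \<Rightarrow> real) \<Rightarrow> bool" where
  "locally_integrable u \<longleftrightarrow> (\<forall>K. compact K \<longrightarrow> u absolutely_integrable_on K)"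

fun C_k :: "nat \<Rightarrow> ('a::euclidean_space \<Rightarrow> real) \<Rightarrow> bool" where
  "C_k 0 f \<longleftrightarrow> continuous_on UNIV f"
| "C_k (Suc k) f \<longleftrightarrow> (\<forall>x. f differentiable (at x)) \<and>
     (\<forall>b\<in>Basis. C_k k (\<lambda>x. frechet_derivative f (at x) b))"

definition test_function :: "('a::euclidean_space \<Rightarrow> real) \<Rightarrow> bool" where
  "test_function f \<longleftrightarrow> (\<forall>k. C_k k f) \<and> compact (closure {x. f x \<noteq> 0})"

(* Vector-valued Borel measures are set functions whose values outside "sets borel" are
   irrelevant. Having values in a finite-dimensional space they are finite, and every finite
   Borel measure on a Euclidean space is a Radon measure. The sum on the right-hand side
   converges absolutely, since it converges for every rearrangement of the sets; taking all
   the sets empty gives mu {} = 0. *)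
definition vector_measure ::
    "('a::euclidean_space set \<Rightarrow> 'b::euclidean_space) \<Rightarrow> bool" where
  "vector_measure \<mu> \<longleftrightarrow>
     (\<forall>A::nat \<Rightarrow> 'a set. range A \<subseteq> sets borel \<longrightarrow> disjoint_family A \<longrightarrow>
        (\<lambda>i. \<mu> (A i)) sums \<mu> (\<Union>i. A i))"

definition total_variation ::
    "('a::euclidean_space set \<Rightarrow> 'b::euclidean_space) \<Rightarrow> 'a set \<Rightarrow> ennreal" where
  "total_variation \<mu> B =
     (SUP A\<in>{A::nat \<Rightarrow> 'a set. range A \<subseteq> sets borel \<and> disjoint_family A \<and> (\<Union>i. A i) = B}.
        \<Sum>i. ennreal (norm (\<mu> (A i))))"

(* The positive part in the Jordan decomposition of a real-valued measure; the negative part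
   is the positive part of its negation. The function "ennreal" sends negative numbers to 0,
   which does not change the supremum because E = {} contributes 0. *)
definition positive_part :: "('a::euclidean_space set \<Rightarrow> real) \<Rightarrow> 'a measure" where
  "positive_part \<nu> = measure_of UNIV (sets borel)
     (\<lambda>A. SUP E\<in>{E\<in>sets borel. E \<subseteq> A}. ennreal (\<nu> E))"

definition signed_integral ::
    "('a::euclidean_space set \<Rightarrow> real) \<Rightarrow> ('a \<Rightarrow> real) \<Rightarrow> real" where
  "signed_integral \<nu> f =
     integral\<^sup>L (positive_part \<nu>) f - integral\<^sup>L (positive_part (\<lambda>A. - \<nu> A)) f"

definition has_gradient_measure ::
    "('a::euclidean_space \<Rightarrow> real) \<Rightarrow> ('a set \<Rightarrow> 'a) \<Rightarrow> bool" where
  "has_gradient_measure u \<mu> \<longleftrightarrow> vector_measure \<mu> \<and>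
     (\<forall>\<phi>. test_function \<phi> \<longrightarrow> (\<forall>b\<in>Basis.
        integral\<^sup>L lebesgue (\<lambda>x. u x * frechet_derivative \<phi> (at x) b)
          = - signed_integral (\<lambda>A. \<mu> A \<bullet> b) \<phi>))"

definition BV_dot :: "('a::euclidean_space \<Rightarrow> real) set" where
  "BV_dot = {u. locally_integrable u \<and> (\<exists>\<mu>. has_gradient_measure u \<mu>)}"

(* For u in BV_dot the choice is unique on Borel sets. *)
definition gradient_measure ::
    "('a::euclidean_space \<Rightarrow> real) \<Rightarrow> 'a set \<Rightarrow> 'a" where
  "gradient_measure u = (SOME \<mu>. has_gradient_measure u \<mu>)"

(* The Hausdorff measure of integer dimension k, normalised so that it agrees with Lebesgue
   measure when k is the dimension of the space. The case distinction only matters for k = 0,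
   where 0 ^ 0 = 1 would make empty covering sets count. Boundedness has to be required
   because "diameter" is unspecified on unbounded sets. *)
definition hausdorff_premeasure ::
    "nat \<Rightarrow> real \<Rightarrow> 'a::euclidean_space set \<Rightarrow> ennreal" where
  "hausdorff_premeasure k r B =
     (INF C\<in>{C::nat \<Rightarrow> 'a set. B \<subseteq> (\<Union>i. C i) \<and> (\<forall>i. bounded (C i) \<and> diameter (C i) \<le> r)}.
        \<Sum>i. if C i = {} then 0
            else ennreal (unit_ball_vol (real k) * (diameter (C i) / 2) ^ k))"

definition hausdorff_measure :: "nat \<Rightarrow> 'a::euclidean_space set \<Rightarrow> ennreal" where
  "hausdorff_measure k B = (SUP r\<in>{0<..}. hausdorff_premeasure k r B)"

end

theory Submission
  imports Defs "HOL-Real_Asymp.Real_Asymp" "HOL-Computational_Algebra.Polynomial"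
begin

text \<open>Fix a coordinate direction \<open>b\<close> and let \<open>\<nu> = Du \<bullet> b\<close>. Only the derivative of \<open>u\<close> in the
  direction \<open>b\<close> enters \<open>\<nu>\<close>: for a product test function \<open>\<alpha>(y) \<beta>(t)\<close>, where \<open>t = x \<bullet> b\<close> and \<open>y\<close>
  collects the other coordinates, one has \<open>\<integral> \<alpha> \<beta> d\<nu> = - \<integral> u \<alpha> \<beta>' dx\<close>. Since no derivative falls
  on \<open>\<alpha>\<close>, this identity extends from smooth \<open>\<alpha>\<close> to indicators of Borel sets, and it shows that \<open>\<nu>\<close>
  vanishes on every Borel subset of a Lebesgue null cylinder parallel to \<open>b\<close>. A set of small
  \<open>(d - 1)\<close>-dimensional Hausdorff measure lies in a cylinder parallel to \<open>b\<close> over a set of small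
  \<open>(d - 1)\<close>-dimensional Lebesgue measure, so Borel--Cantelli turns the vanishing on null cylinders
  into the \<open>\<epsilon>\<close>-\<open>\<delta>\<close> statement. Neither truncation of \<open>u\<close> nor the coarea formula is needed.\<close>

subsection \<open>Finite signed measures\<close>

lemma vector_measure_sums:
  assumes "vector_measure \<mu>" "\<And>i::nat. A i \<in> sets borel" "disjoint_family A"
  shows "(\<lambda>i. \<mu> (A i)) sums \<mu> (\<Union>i. A i)"
  using assms unfolding vector_measure_def by blast

lemma vector_measure_empty:
  assumes "vector_measure \<mu>"
  shows "\<mu> {} = 0"
proof -
  have "(\<lambda>i::nat. \<mu> {}) sums \<mu> (\<Union>i::nat. {})"
    by (rule vector_measure_sums[OF assms]) (auto simp: disjoint_family_on_def)
  then have "summable (\<lambda>i::nat. \<mu> {})" by (rule sums_summable)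
  then show ?thesis by (simp add: summable_const_iff)
qed

lemma vector_measure_Un:
  assumes "vector_measure \<mu>" "A \<in> sets borel" "B \<in> sets borel" "A \<inter> B = {}"
  shows "\<mu> (A \<union> B) = \<mu> A + \<mu> B"
proof -
  have "(\<lambda>i. \<mu> (binaryset A B i)) sums \<mu> (\<Union>i. binaryset A B i)"
    using assms(2-4)
    by (intro vector_measure_sums[OF assms(1)])
       (auto simp: binaryset_def disjoint_family_on_def)
  moreover have "(\<lambda>i. \<mu> (binaryset A B i)) sums (\<mu> A + \<mu> B)"
    by (rule binaryset_sums) (rule vector_measure_empty[OF assms(1)])
  ultimately show ?thesis
    by (simp add: UN_binaryset_eq sums_unique2)
qed

lemma vector_measure_Diff:
  assumes "vector_measure \<mu>" "A \<in> sets borel" "B \<in> sets borel" "B \<subseteq> A"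
  shows "\<mu> (A - B) = \<mu> A - \<mu> B"
proof -
  have "\<mu> (A - B \<union> B) = \<mu> (A - B) + \<mu> B"
    using assms(2-4) by (intro vector_measure_Un[OF assms(1)]) auto
  moreover have "A - B \<union> B = A" using assms(4) by auto
  ultimately show ?thesis by simp
qed

lemma vector_measure_uminus:
  "vector_measure \<mu> \<Longrightarrow> vector_measure (\<lambda>A. - \<mu> A)"
  unfolding vector_measure_def by (simp add: sums_minus)

lemma vector_measure_inner:
  "vector_measure \<mu> \<Longrightarrow> vector_measure (\<lambda>A. \<mu> A \<bullet> b)"
  unfolding vector_measure_def
  by (simp add: bounded_linear.sums[OF bounded_linear_inner_left])

text \<open>If \<open>\<nu>\<close> were unbounded on the Borel subsets of some set, one could repeatedly split off
  disjoint pieces on which \<open>\<bar>\<nu>\<bar> \<ge> 1\<close>, contradicting the convergence of the series of their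
  values.\<close>

lemma vector_measure_bounded:
  fixes \<nu> :: "'a::euclidean_space set \<Rightarrow> real"
  assumes \<nu>: "vector_measure \<nu>"
  obtains M where "\<And>A. A \<in> sets borel \<Longrightarrow> \<bar>\<nu> A\<bar> \<le> M"
proof (rule ccontr)
  define bad where
    "bad A \<longleftrightarrow> A \<in> sets borel \<and> (\<forall>M. \<exists>E\<in>sets borel. E \<subseteq> A \<and> \<bar>\<nu> E\<bar> > M)" for A
  assume "\<not> thesis"
  then have bad_UNIV: "bad UNIV"
    unfolding bad_def using that by (metis not_le subset_UNIV sets.top space_borel)
  have step: "\<exists>E. bad E \<and> E \<subseteq> A \<and> \<bar>\<nu> (A - E)\<bar> \<ge> 1" if A: "bad A" for A
  proof -
    have Ab: "A \<in> sets borel" using A by (simp add: bad_def)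
    \<comment> \<open>The margin \<open>\<bar>\<nu> A\<bar> + 1\<close> forces both \<open>E\<close>
      and \<open>A - E\<close> to have values of modulus at least 1. Either one can thus be split
      off, whichever leaves an unbounded remainder.\<close>
    obtain E where E: "E \<in> sets borel" "E \<subseteq> A" "\<bar>\<nu> E\<bar> > \<bar>\<nu> A\<bar> + 1"
      using A unfolding bad_def by blast
    have d: "\<nu> (A - E) = \<nu> A - \<nu> E"
      by (rule vector_measure_Diff[OF \<nu> Ab E(1,2)])
    have "bad E \<or> bad (A - E)"
    proof (rule ccontr)
      assume "\<not> ?thesis"
      then have "\<not> bad E" "\<not> bad (A - E)" by auto
      then obtain M1 M2
        where M: "\<forall>F\<in>sets borel. F \<subseteq> E \<longrightarrow> \<bar>\<nu> F\<bar> \<le> M1"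
          "\<forall>F\<in>sets borel. F \<subseteq> A - E \<longrightarrow> \<bar>\<nu> F\<bar> \<le> M2"
        using Ab E(1) sets.Diff[OF Ab E(1)] unfolding bad_def by (meson not_less)
      obtain F where F: "F \<in> sets borel" "F \<subseteq> A" "\<bar>\<nu> F\<bar> > M1 + M2"
        using A unfolding bad_def by blast
      have "\<nu> ((F \<inter> E) \<union> (F - E)) = \<nu> (F \<inter> E) + \<nu> (F - E)"
        using F E by (intro vector_measure_Un[OF \<nu>]) auto
      then have "\<nu> F = \<nu> (F \<inter> E) + \<nu> (F - E)"
        by (simp add: Int_Diff_Un)
      moreover have "\<bar>\<nu> (F \<inter> E)\<bar> \<le> M1" "\<bar>\<nu> (F - E)\<bar> \<le> M2"
        using F E by (auto intro: M(1)[rule_format] M(2)[rule_format])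
      ultimately show False using F(3) by linarith
    qed
    then show ?thesis
    proof
      assume "bad E"
      then show ?thesis using E d by (intro exI[of _ E]) auto
    next
      assume *: "bad (A - E)"
      have "A - (A - E) = E" using E by auto
      then show ?thesis using * E by (intro exI[of _ "A - E"]) auto
    qed
  qed
  obtain A where A: "\<And>n::nat. bad (A n)" "\<And>n. A (Suc n) \<subseteq> A n \<and> \<bar>\<nu> (A n - A (Suc n))\<bar> \<ge> 1"
    using dependent_nat_choice[of "\<lambda>n A. bad A" "\<lambda>n A E. E \<subseteq> A \<and> \<bar>\<nu> (A - E)\<bar> \<ge> 1"]
      bad_UNIV step by metis
  have "decseq A" using A(2) by (simp add: decseq_Suc_iff)
  then have "disjoint_family (\<lambda>n. A n - A (Suc n))"
    unfolding disjoint_family_on_def disjoint_iff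
    by (metis DiffD1 DiffD2 Suc_leI decseqD linorder_neqE_nat subsetD)
  then have "(\<lambda>n. \<nu> (A n - A (Suc n))) sums \<nu> (\<Union>n. A n - A (Suc n))"
    using A(1) by (intro vector_measure_sums[OF \<nu>]) (auto simp: bad_def)
  then have "(\<lambda>n. \<nu> (A n - A (Suc n))) \<longlonglongrightarrow> 0"
    by (auto dest: sums_summable summable_LIMSEQ_zero)
  then have "\<forall>\<^sub>F n in sequentially. \<bar>\<nu> (A n - A (Suc n))\<bar> < 1"
    by (auto simp: tendsto_iff dest!: spec[of _ 1])
  then obtain n where "\<bar>\<nu> (A n - A (Suc n))\<bar> < 1"
    by (auto simp: eventually_sequentially)
  with A(2)[of n] show False by linarith
qed

section \<open>Positive part of a signed measure and the Jordan decomposition\<close>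

lemma sets_positive_part [simp, measurable_cong]:
  "sets (positive_part (\<nu> :: 'a::euclidean_space set \<Rightarrow> real)) = sets borel"
  using sets.sigma_sets_eq[of "borel :: 'a measure"] by (simp add: positive_part_def)

lemma space_positive_part [simp]: "space (positive_part \<nu>) = UNIV"
  by (simp add: positive_part_def)

context
  fixes \<nu> :: "'a::euclidean_space set \<Rightarrow> real"
  assumes \<nu>: "vector_measure \<nu>"
begin

text \<open>One half of countable additivity of the supremum formula: \<open>E\<close> is cut into
  the pieces \<open>E \<inter> A i\<close>, each of which competes in its own supremum.\<close>

private lemma SUP_subset_le_add:
  assumes A: "\<And>i::nat. A i \<in> sets borel" "disjoint_family A"
    and E: "E \<in> sets borel" "E \<subseteq> (\<Union>i. A i)"
  shows "ennreal (\<nu> E) \<le> (\<Sum>i. SUP E\<in>{E\<in>sets borel. E \<subseteq> A i}. ennreal (\<nu> E))"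
proof -
  have "(\<lambda>i. \<nu> (E \<inter> A i)) sums \<nu> (\<Union>i. E \<inter> A i)"
    using A E by (intro vector_measure_sums[OF \<nu>]) (auto simp: disjoint_family_on_def)
  moreover have "(\<Union>i. E \<inter> A i) = E" using E by auto
  ultimately have "(\<lambda>n. \<Sum>i<n. \<nu> (E \<inter> A i)) \<longlonglongrightarrow> \<nu> E"
    by (simp add: sums_def)
  then have "(\<lambda>n. ennreal (\<Sum>i<n. \<nu> (E \<inter> A i))) \<longlonglongrightarrow> ennreal (\<nu> E)"
    by (rule tendsto_ennrealI)
  then show ?thesis
  proof (rule LIMSEQ_le_const2, intro exI allI impI)
    fix n
    \<comment> \<open>As \<open>ennreal\<close> truncates at 0, it commutes with a sum only for
      nonnegative terms; hence the detour through \<open>max 0\<close>.\<close>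
    have "ennreal (\<Sum>i<n. \<nu> (E \<inter> A i)) \<le> ennreal (\<Sum>i<n. max 0 (\<nu> (E \<inter> A i)))"
      by (intro ennreal_leI sum_mono) auto
    also have "\<dots> = (\<Sum>i<n. ennreal (\<nu> (E \<inter> A i)))"
      by (subst sum_ennreal[symmetric]) (auto simp: ennreal_max_0)
    also have "\<dots> \<le> (\<Sum>i<n. SUP E\<in>{E\<in>sets borel. E \<subseteq> A i}. ennreal (\<nu> E))"
      using A E by (intro sum_mono SUP_upper) auto
    also have "\<dots> \<le> (\<Sum>i. SUP E\<in>{E\<in>sets borel. E \<subseteq> A i}. ennreal (\<nu> E))"
      by (intro sum_le_suminf) auto
    finally show "ennreal (\<Sum>i<n. \<nu> (E \<inter> A i))
        \<le> (\<Sum>i. SUP E\<in>{E\<in>sets borel. E \<subseteq> A i}. ennreal (\<nu> E))" .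
  qed
qed

text \<open>The other half of additivity, for two sets. If both values are nonnegative,
  \<open>E \<union> F\<close> competes on the right; if one is negative it counts as 0 and the other
  set competes alone.\<close>

private lemma add_SUP_subset_le:
  assumes A: "A \<in> sets borel" "B \<in> sets borel" "A \<inter> B = {}"
  shows "(SUP E\<in>{E\<in>sets borel. E \<subseteq> A}. ennreal (\<nu> E)) + (SUP E\<in>{E\<in>sets borel. E \<subseteq> B}. ennreal (\<nu> E))
    \<le> (SUP E\<in>{E\<in>sets borel. E \<subseteq> A \<union> B}. ennreal (\<nu> E))" (is "?s A + ?s B \<le> ?s (A \<union> B)")
proof -
  have mono: "?s C \<le> ?s (A \<union> B)" if "C \<subseteq> A \<union> B" for C
    using that by (intro SUP_subset_mono) auto
  have *: "ennreal (\<nu> E) + ennreal (\<nu> F) \<le> ?s (A \<union> B)"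
    if E: "E \<in> sets borel" "E \<subseteq> A" and F: "F \<in> sets borel" "F \<subseteq> B" for E F
  proof (cases "\<nu> E \<ge> 0 \<and> \<nu> F \<ge> 0")
    case True
    have "\<nu> (E \<union> F) = \<nu> E + \<nu> F"
      using E F A by (intro vector_measure_Un[OF \<nu>]) auto
    then have "ennreal (\<nu> E) + ennreal (\<nu> F) = ennreal (\<nu> (E \<union> F))"
      using True by simp
    also have "\<dots> \<le> ?s (A \<union> B)" using E F by (intro SUP_upper) auto
    finally show ?thesis .
  next
    case False
    then have "ennreal (\<nu> E) + ennreal (\<nu> F) = ennreal (\<nu> E) \<or>
        ennreal (\<nu> E) + ennreal (\<nu> F) = ennreal (\<nu> F)"
      by (auto simp: ennreal_neg not_le)
    moreover have "ennreal (\<nu> E) \<le> ?s (A \<union> B)" "ennreal (\<nu> F) \<le> ?s (A \<union> B)"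
      using E F by (auto intro!: SUP_upper)
    ultimately show ?thesis by auto
  qed
  have ne: "{E\<in>sets borel. E \<subseteq> C} \<noteq> {}" for C :: "'a set" by auto
  have "?s A + ?s B = (SUP E\<in>{E\<in>sets borel. E \<subseteq> A}. ennreal (\<nu> E) + ?s B)"
    by (rule ennreal_SUP_add_left[symmetric]) (rule ne)
  also have "\<dots> = (SUP E\<in>{E\<in>sets borel. E \<subseteq> A}. SUP F\<in>{E\<in>sets borel. E \<subseteq> B}. ennreal (\<nu> E) + ennreal (\<nu> F))"
    by (intro SUP_cong refl ennreal_SUP_add_right ne)
  also have "\<dots> \<le> ?s (A \<union> B)"
    using * by (intro SUP_least) auto
  finally show ?thesis .
qed

text \<open>\<open>measure_of\<close> falls back to the zero measure unless its set function is a
  measure, so the formula becomes available only through countable additivity, which the two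
  preceding inequalities provide.\<close>

lemma emeasure_positive_part:
  assumes "A \<in> sets borel"
  shows "emeasure (positive_part \<nu>) A = (SUP E\<in>{E\<in>sets borel. E \<subseteq> A}. ennreal (\<nu> E))"
proof (rule emeasure_measure_of[OF positive_part_def])
  let ?s = "\<lambda>A. SUP E\<in>{E\<in>sets borel. E \<subseteq> A}. ennreal (\<nu> E)"
  show "positive (sets (positive_part \<nu>)) ?s"
  proof -
    have "{E \<in> sets borel. E = ({}::'a set)} = {{}}" by auto
    then show ?thesis by (auto simp: positive_def vector_measure_empty[OF \<nu>])
  qed
  show "countably_additive (sets (positive_part \<nu>)) ?s"
  proof (rule countably_additiveI)
    fix A :: "nat \<Rightarrow> 'a set"
    assume "range A \<subseteq> sets (positive_part \<nu>)" and disj: "disjoint_family A"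
    then have A: "A i \<in> sets borel" for i by auto
    show "(\<Sum>i. ?s (A i)) = ?s (\<Union>i. A i)"
    proof (rule antisym)
      show "?s (\<Union>i. A i) \<le> (\<Sum>i. ?s (A i))"
        using A disj by (intro SUP_least) (auto intro!: SUP_subset_le_add)
      \<comment> \<open>Superadditivity passes from two sets to finite unions by induction;
        monotonicity then bounds every partial sum by the value at the full union.\<close>
      have "(\<Sum>i<n. ?s (A i)) \<le> ?s (\<Union>i<n. A i)" for n
      proof (induction n)
        case (Suc n)
        have "(\<Sum>i<Suc n. ?s (A i)) \<le> ?s (\<Union>i<n. A i) + ?s (A n)"
          using Suc by (simp add: add_right_mono)
        also have "\<dots> \<le> ?s ((\<Union>i<n. A i) \<union> A n)"
        proof (rule add_SUP_subset_le)
          show "(\<Union>i<n. A i) \<inter> A n = {}"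
            using disj by (auto simp: disjoint_family_on_def) (metis IntI empty_iff less_irrefl)
        qed (use A in auto)
        also have "(\<Union>i<n. A i) \<union> A n = (\<Union>i<Suc n. A i)"
          by (auto simp: lessThan_Suc)
        finally show ?case .
      qed simp
      also have "?s (\<Union>i<n. A i) \<le> ?s (\<Union>i. A i)" for n
        by (intro SUP_subset_mono) auto
      finally show "(\<Sum>i. ?s (A i)) \<le> ?s (\<Union>i. A i)"
        by (intro suminf_le_const) auto
    qed
  qed
qed (use assms in auto)

lemma finite_measure_positive_part: "finite_measure (positive_part \<nu>)"
proof
  obtain M where M: "\<And>A. A \<in> sets borel \<Longrightarrow> \<bar>\<nu> A\<bar> \<le> M"
    using vector_measure_bounded[OF \<nu>] by blast
  have "emeasure (positive_part \<nu>) UNIV \<le> ennreal M"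
    by (subst emeasure_positive_part)
       (auto intro!: SUP_least ennreal_leI dest: M simp: abs_le_iff)
  then show "emeasure (positive_part \<nu>) (space (positive_part \<nu>)) \<noteq> \<infinity>"
    by (auto simp: top_unique)
qed

lemma le_measure_positive_part:
  assumes "A \<in> sets borel" "E \<in> sets borel" "E \<subseteq> A"
  shows "\<nu> E \<le> measure (positive_part \<nu>) A"
proof -
  interpret finite_measure "positive_part \<nu>" by (rule finite_measure_positive_part)
  have "ennreal (\<nu> E) \<le> ennreal (measure (positive_part \<nu>) A)"
    using assms by (auto simp: emeasure_eq_measure[symmetric] emeasure_positive_part intro!: SUP_upper)
  then show ?thesis
    by (simp add: ennreal_le_iff)
qed

lemma measure_positive_part_le:
  assumes "A \<in> sets borel" "\<And>E. E \<in> sets borel \<Longrightarrow> E \<subseteq> A \<Longrightarrow> \<nu> E \<le> c"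
  shows "measure (positive_part \<nu>) A \<le> c"
proof -
  interpret finite_measure "positive_part \<nu>" by (rule finite_measure_positive_part)
  have "c \<ge> 0" using assms(2)[of "{}"] by (simp add: vector_measure_empty[OF \<nu>])
  have "ennreal (measure (positive_part \<nu>) A) \<le> ennreal c"
    using assms by (auto simp: emeasure_eq_measure[symmetric] emeasure_positive_part
        intro!: SUP_least ennreal_leI)
  with \<open>c \<ge> 0\<close> show ?thesis by simp
qed

end

text \<open>The Jordan decomposition. Since \<open>\<nu> (A - E) = \<nu> A - \<nu> E\<close>,
  passing from \<open>E\<close> to \<open>A - E\<close> exchanges the competitors for the two
  suprema up to the constant \<open>\<nu> A\<close>.\<close>

lemma measure_positive_part_uminus:
  fixes \<nu> :: "'a::euclidean_space set \<Rightarrow> real"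
  assumes \<nu>: "vector_measure \<nu>" and A: "A \<in> sets borel"
  shows "measure (positive_part (\<lambda>A. - \<nu> A)) A = measure (positive_part \<nu>) A - \<nu> A"
proof (rule antisym)
  note \<nu>' = vector_measure_uminus[OF \<nu>]
  show "measure (positive_part (\<lambda>A. - \<nu> A)) A \<le> measure (positive_part \<nu>) A - \<nu> A"
  proof (rule measure_positive_part_le[OF \<nu>' A])
    fix E :: "'a set" assume E: "E \<in> sets borel" "E \<subseteq> A"
    have "\<nu> (A - E) \<le> measure (positive_part \<nu>) A"
      using E A by (intro le_measure_positive_part[OF \<nu>]) auto
    then show "- \<nu> E \<le> measure (positive_part \<nu>) A - \<nu> A"
      using vector_measure_Diff[OF \<nu> A E] by simp
  qed
  have "measure (positive_part \<nu>) A \<le> measure (positive_part (\<lambda>A. - \<nu> A)) A + \<nu> A"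
  proof (rule measure_positive_part_le[OF \<nu> A])
    fix E :: "'a set" assume E: "E \<in> sets borel" "E \<subseteq> A"
    have "- \<nu> (A - E) \<le> measure (positive_part (\<lambda>A. - \<nu> A)) A"
      using E A by (intro le_measure_positive_part[OF \<nu>']) auto
    then show "\<nu> E \<le> measure (positive_part (\<lambda>A. - \<nu> A)) A + \<nu> A"
      using vector_measure_Diff[OF \<nu> A E] by simp
  qed
  then show "measure (positive_part \<nu>) A - \<nu> A \<le> measure (positive_part (\<lambda>A. - \<nu> A)) A"
    by simp
qed

text \<open>On each piece of a partition the norm is at most the sum of the moduli of the
  coordinates, and each modulus is at most positive plus negative part. Those are measures, so
  summing over the pieces gives back their values on \<open>B\<close>.\<close>

lemma total_variation_le:
  fixes \<mu> :: "'a::euclidean_space set \<Rightarrow> 'b::euclidean_space"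
  assumes \<mu>: "vector_measure \<mu>" and B: "B \<in> sets borel"
  shows "total_variation \<mu> B \<le> (\<Sum>b\<in>Basis. emeasure (positive_part (\<lambda>A. \<mu> A \<bullet> b)) B
           + emeasure (positive_part (\<lambda>A. - (\<mu> A \<bullet> b))) B)"
  unfolding total_variation_def
proof (rule SUP_least, safe)
  fix A :: "nat \<Rightarrow> 'a set"
  assume A: "range A \<subseteq> sets borel" "disjoint_family A"
  let ?P = "\<lambda>b. positive_part (\<lambda>A. \<mu> A \<bullet> b)"
  let ?N = "\<lambda>b. positive_part (\<lambda>A. - (\<mu> A \<bullet> b))"
  note P = vector_measure_inner[OF \<mu>]
  note N = vector_measure_uminus[OF P]
  have "ennreal (norm (\<mu> (A i))) \<le> (\<Sum>b\<in>Basis. emeasure (?P b) (A i) + emeasure (?N b) (A i))" for i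
  proof -
    have Ai: "A i \<in> sets borel" using A by auto
    have "ennreal (norm (\<mu> (A i))) \<le> ennreal (\<Sum>b\<in>Basis. \<bar>\<mu> (A i) \<bullet> b\<bar>)"
      by (intro ennreal_leI norm_le_l1)
    also have "\<dots> = (\<Sum>b\<in>Basis. ennreal \<bar>\<mu> (A i) \<bullet> b\<bar>)"
      by (subst sum_ennreal) auto
    also have "\<dots> \<le> (\<Sum>b\<in>Basis. emeasure (?P b) (A i) + emeasure (?N b) (A i))"
    proof (rule sum_mono)
      fix b :: 'b
      have "ennreal (\<mu> (A i) \<bullet> b) \<le> emeasure (?P b) (A i)"
        "ennreal (- (\<mu> (A i) \<bullet> b)) \<le> emeasure (?N b) (A i)"
        using Ai by (auto simp: emeasure_positive_part[OF P] emeasure_positive_part[OF N] intro!: SUP_upper)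
      moreover have "ennreal \<bar>\<mu> (A i) \<bullet> b\<bar> = ennreal (\<mu> (A i) \<bullet> b) + ennreal (- (\<mu> (A i) \<bullet> b))"
        by (cases "\<mu> (A i) \<bullet> b \<ge> 0") (auto simp: ennreal_neg not_le)
      ultimately show "ennreal \<bar>\<mu> (A i) \<bullet> b\<bar> \<le> emeasure (?P b) (A i) + emeasure (?N b) (A i)"
        by (simp add: add_mono)
    qed
    finally show ?thesis .
  qed
  then have "(\<Sum>i. ennreal (norm (\<mu> (A i))))
      \<le> (\<Sum>i. \<Sum>b\<in>Basis. emeasure (?P b) (A i) + emeasure (?N b) (A i))"
    by (intro suminf_le) auto
  also have "\<dots> = (\<Sum>b\<in>Basis. (\<Sum>i. emeasure (?P b) (A i)) + (\<Sum>i. emeasure (?N b) (A i)))"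
    by (subst suminf_sum) (auto simp: suminf_add[symmetric])
  also have "\<dots> = (\<Sum>b\<in>Basis. emeasure (?P b) (\<Union>i. A i) + emeasure (?N b) (\<Union>i. A i))"
    using A by (intro sum.cong refl arg_cong2[where f="(+)"] suminf_emeasure)
      auto
  finally show "(\<Sum>i. ennreal (norm (\<mu> (A i))))
      \<le> (\<Sum>b\<in>Basis. emeasure (?P b) (\<Union>i. A i) + emeasure (?N b) (\<Union>i. A i))" .
qed

section \<open>Constructing vector measures and recognising the zero measure\<close>

lemma vector_measure_add:
  "vector_measure \<mu> \<Longrightarrow> vector_measure \<nu> \<Longrightarrow> vector_measure (\<lambda>A. \<mu> A + \<nu> A)"
  unfolding vector_measure_def by (simp add: sums_add)

lemma vector_measure_restrict:
  assumes "vector_measure \<mu>" "S \<in> sets borel"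
  shows "vector_measure (\<lambda>A. \<mu> (S \<inter> A))"
  unfolding vector_measure_def
proof (intro allI impI)
  fix A :: "nat \<Rightarrow> 'a set"
  assume "range A \<subseteq> sets borel" "disjoint_family A"
  then have "(\<lambda>i. \<mu> (S \<inter> A i)) sums \<mu> (\<Union>i. S \<inter> A i)"
    using assms(2) by (intro vector_measure_sums[OF assms(1)]) (auto simp: disjoint_family_on_def)
  then show "(\<lambda>i. \<mu> (S \<inter> A i)) sums \<mu> (S \<inter> (\<Union>i. A i))" by simp
qed

text \<open>This is the image under \<open>f\<close> of the signed measure with density
  \<open>p\<close>; countable additivity is dominated convergence with bound
  \<open>\<bar>p x\<bar>\<close>. With \<open>f = drop_coord b\<close> it makes each term of the
  integration by parts a measure in the cross section of the cylinder.\<close>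

lemma vector_measure_integral:
  fixes p :: "'x \<Rightarrow> real" and f :: "'x \<Rightarrow> 'a::euclidean_space"
  assumes f [measurable]: "f \<in> borel_measurable M" and p: "integrable M p"
  shows "vector_measure (\<lambda>T. \<integral>x. indicator T (f x) * p x \<partial>M)"
  unfolding vector_measure_def
proof (intro allI impI)
  fix A :: "nat \<Rightarrow> 'a set"
  assume A': "range A \<subseteq> sets borel" and disj: "disjoint_family A"
  then have A [measurable]: "A i \<in> sets borel" for i by auto
  note p' [measurable] = borel_measurable_integrable[OF p]
  have int: "integrable M (\<lambda>x. indicator T (f x) * p x)" if [measurable]: "T \<in> sets borel" for T
    by (rule Bochner_Integration.integrable_bound[OF p]) (auto simp: indicator_def)
  have "(\<Sum>i<n. indicator (A i) y) = (indicator (\<Union>i<n. A i) y :: real)" for n y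
    using disj by (intro indicator_UN_disjoint[symmetric]) (auto simp: disjoint_family_on_def)
  then have "(\<Sum>i<n. \<integral>x. indicator (A i) (f x) * p x \<partial>M)
      = (\<integral>x. indicator (\<Union>i<n. A i) (f x) * p x \<partial>M)" for n
    by (subst Bochner_Integration.integral_sum[symmetric]) (auto simp: int sum_distrib_right[symmetric])
  moreover have "(\<lambda>n. \<integral>x. indicator (\<Union>i<n. A i) (f x) * p x \<partial>M)
      \<longlonglongrightarrow> (\<integral>x. indicator (\<Union>i. A i) (f x) * p x \<partial>M)"
  proof (rule integral_dominated_convergence[where w = "\<lambda>x. \<bar>p x\<bar>"])
    show "AE x in M. (\<lambda>n. indicator (\<Union>i<n. A i) (f x) * p x) \<longlonglongrightarrow> indicator (\<Union>i. A i) (f x) * p x"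
      by (intro AE_I2 tendsto_mult LIMSEQ_indicator_UN tendsto_const)
  qed (use p in \<open>auto simp: indicator_def\<close>)
  ultimately show "(\<lambda>i. \<integral>x. indicator (A i) (f x) * p x \<partial>M)
      sums (\<integral>x. indicator (\<Union>i. A i) (f x) * p x \<partial>M)"
    by (simp add: sums_def)
qed

lemma vector_measure_eq_0:
  fixes \<rho> :: "'a::euclidean_space set \<Rightarrow> 'b::euclidean_space"
  assumes \<rho>: "vector_measure \<rho>" and box: "\<And>l u. \<rho> (box l u) = 0" and A: "A \<in> sets borel"
  shows "\<rho> A = 0"
proof -
  \<comment> \<open>Boxes are stable under intersection, but the complement step of the Dynkin
    argument needs the value of the ambient set, and \<open>UNIV\<close> is not a box. The cubes
    \<open>B k\<close> are boxes, so the argument runs inside each of them.\<close>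
  define B :: "nat \<Rightarrow> 'a set" where "B k = box (- real k *\<^sub>R One) (real k *\<^sub>R One)" for k
  have B [measurable]: "B k \<in> sets borel" for k by (simp add: B_def)
  have zero: "\<rho> (A \<inter> B k) = 0" if "A \<in> sets borel" for A k
  proof -
    have "Int_stable (range (\<lambda>(a, b). box a b :: 'a set))"
      by (auto simp: Int_stable_def box_Int_box)
    moreover have "(range (\<lambda>(a, b). box a b :: 'a set)) \<subseteq> Pow UNIV"
      by auto
    moreover have "A \<in> sigma_sets UNIV (range (\<lambda>(a, b). box a b :: 'a set))"
      using that unfolding borel_eq_box by simp
    ultimately show ?thesis
    proof (induction rule: sigma_sets_induct_disjoint)
      case (basic A)
      then show ?case by (auto simp: B_def box_Int_box box)
    next
      case empty
      then show ?case by (simp add: vector_measure_empty[OF \<rho>])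
    next
      case (compl A)
      then have A: "A \<in> sets borel" by (simp add: borel_eq_box)
      have "\<rho> (B k - A \<inter> B k) = \<rho> (B k) - \<rho> (A \<inter> B k)"
        using A by (intro vector_measure_Diff[OF \<rho>]) auto
      moreover have "B k - A \<inter> B k = (UNIV - A) \<inter> B k" by auto
      moreover have "\<rho> (B k) = 0" by (simp add: B_def box)
      ultimately show ?case using compl by simp
    next
      case (union F)
      then have F: "F i \<in> sets borel" for i by (auto simp: borel_eq_box)
      have "(\<lambda>i. \<rho> (F i \<inter> B k)) sums \<rho> (\<Union>i. F i \<inter> B k)"
        using F union by (intro vector_measure_sums[OF \<rho>]) (auto simp: disjoint_family_on_def)
      then have "\<rho> (\<Union>i. F i \<inter> B k) = 0"
        using union by (simp add: sums_unique2[OF _ sums_zero])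
      then show ?case by (simp add: Int_UN_distrib2)
    qed
  qed
  \<comment> \<open>The successive differences of the increasing sets \<open>?T k\<close> are
    disjoint with union \<open>A\<close>, so countable additivity carries the value 0 from the cubes
    to \<open>A\<close>.\<close>
  let ?T = "\<lambda>k. A \<inter> B k"
  have mono: "mono ?T"
  proof (rule monoI)
    fix m n :: nat assume "m \<le> n"
    then have "real m \<le> real n" by simp
    then show "?T m \<subseteq> ?T n" unfolding B_def box_def by force
  qed
  have "\<rho> (disjointed ?T n) = 0" for n
  proof (cases n)
    case (Suc m)
    have "\<rho> (?T n - ?T m) = \<rho> (?T n) - \<rho> (?T m)"
      using A monoD[OF mono, of m n] Suc by (intro vector_measure_Diff[OF \<rho>]) auto
    then show ?thesis
      unfolding Suc disjointed_mono[OF mono] using zero[OF A] Suc by simp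
  qed (simp add: disjointed_def zero[OF A])
  moreover have "(\<lambda>n. \<rho> (disjointed ?T n)) sums \<rho> (\<Union>n. disjointed ?T n)"
    using A by (intro vector_measure_sums[OF \<rho>] disjoint_family_disjointed) (auto simp: disjointed_def)
  moreover have "(\<Union>n. disjointed ?T n) = A"
    unfolding UN_disjointed_eq
  proof safe
    fix x assume "x \<in> A"
    obtain k where "norm x < real k" using reals_Archimedean2 by blast
    then have "\<forall>i\<in>Basis. \<bar>x \<bullet> i\<bar> < real k" by (meson Basis_le_norm le_less_trans)
    then have "x \<in> B k" by (auto simp: B_def mem_box abs_less_iff)
    then show "x \<in> (\<Union>k. A \<inter> B k)" using \<open>x \<in> A\<close> by auto
  qed
  ultimately show ?thesis by (simp add: sums_unique2[OF _ sums_zero])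
qed

subsection \<open>Product test functions\<close>

text \<open>The derivative is an existential witness, so closure under sums, products and affine
  substitution is shown by writing the derivative down.\<close>

fun diff_n :: "nat \<Rightarrow> (real \<Rightarrow> real) \<Rightarrow> bool" where
  "diff_n 0 h \<longleftrightarrow> True"
| "diff_n (Suc n) h \<longleftrightarrow> (\<exists>h'. (\<forall>x. (h has_real_derivative h' x) (at x)) \<and> diff_n n h')"

definition smooth1 :: "(real \<Rightarrow> real) \<Rightarrow> bool" where
  "smooth1 h \<longleftrightarrow> (\<forall>n. diff_n n h)"

lemma diff_n_SucD: "diff_n (Suc n) h \<Longrightarrow> diff_n n h"
proof (induction n arbitrary: h)
  case (Suc n)
  then obtain h' where "\<forall>x. (h has_real_derivative h' x) (at x)" "diff_n (Suc n) h'"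
    by (auto simp del: diff_n.simps simp: diff_n.simps(2)[of "Suc n"])
  with Suc.IH show ?case by auto
qed simp

lemma diff_n_add: "diff_n n f \<Longrightarrow> diff_n n g \<Longrightarrow> diff_n n (\<lambda>x. f x + g x)"
proof (induction n arbitrary: f g)
  case (Suc n)
  then obtain f' g' where "\<forall>x. (f has_real_derivative f' x) (at x)" "diff_n n f'"
    "\<forall>x. (g has_real_derivative g' x) (at x)" "diff_n n g'" by auto
  then show ?case using Suc.IH[of f' g']
    by (auto intro!: exI[of _ "\<lambda>x. f' x + g' x"] derivative_eq_intros)
qed simp

lemma diff_n_mult: "diff_n n f \<Longrightarrow> diff_n n g \<Longrightarrow> diff_n n (\<lambda>x. f x * g x)"
proof (induction n arbitrary: f g)
  case (Suc n)
  then obtain f' g' where *: "\<forall>x. (f has_real_derivative f' x) (at x)" "diff_n n f'"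
    "\<forall>x. (g has_real_derivative g' x) (at x)" "diff_n n g'" by auto
  \<comment> \<open>The product rule pairs each derivative with the other function itself, so
    \<open>f\<close> and \<open>g\<close> have to be lowered to level \<open>n\<close>.\<close>
  have "diff_n n (\<lambda>x. f' x * g x + f x * g' x)"
    using * Suc.prems by (intro diff_n_add Suc.IH) (auto dest!: diff_n_SucD simp del: diff_n.simps)
  then show ?case using *
    by (auto intro!: exI[of _ "\<lambda>x. f' x * g x + f x * g' x"] derivative_eq_intros)
qed simp

lemma diff_n_const: "diff_n n (\<lambda>x. c)"
  by (induction n arbitrary: c) (auto intro!: exI[of _ "\<lambda>x. 0"])

lemma diff_n_affine: "diff_n n f \<Longrightarrow> diff_n n (\<lambda>x. f (a * x + c))"
proof (induction n arbitrary: f)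
  case (Suc n)
  then obtain f' where *: "\<forall>x. (f has_real_derivative f' x) (at x)" "diff_n n f'" by auto
  have "diff_n n (\<lambda>x. f' (a * x + c) * a)"
    by (rule diff_n_mult[OF Suc.IH[OF *(2)] diff_n_const])
  moreover have "((\<lambda>x. f (a * x + c)) has_real_derivative f' (a * x + c) * a) (at x)" for x
    by (rule DERIV_chain2[of f]) (use * in \<open>auto intro!: derivative_eq_intros\<close>)
  ultimately show ?case
    unfolding diff_n.simps by (intro exI[of _ "\<lambda>x. f' (a * x + c) * a"]) simp
qed simp

text \<open>The polynomial factor makes this family closed under differentiation, so that smoothness of
  \<open>exp (- 1 / t)\<close> at \<open>0\<close> follows by a plain induction.\<close>

definition flat :: "real poly \<Rightarrow> real \<Rightarrow> real" where
  "flat p t = (if t > 0 then poly p (1 / t) * exp (- (1 / t)) else 0)"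

lemma poly_div_exp_tendsto_0: "((\<lambda>s. poly p s * exp (- s)) \<longlongrightarrow> 0) (at_top :: real filter)"
proof -
  have "((\<lambda>s. \<Sum>i\<le>degree p. coeff p i * (s ^ i / exp s)) \<longlongrightarrow> (\<Sum>i\<le>degree p. coeff p i * 0)) at_top"
    by (intro tendsto_intros tendsto_power_div_exp_0)
  then show ?thesis
    by (simp add: poly_altdef sum_distrib_right exp_minus divide_inverse mult.assoc)
qed

text \<open>With \<open>s = 1 / t\<close>, the chain rule turns \<open>p s * exp (- s)\<close> into
  \<open>s ^ 2 * (p s - p' s) * exp (- s)\<close>, and \<open>[:0, 0, 1:]\<close> is
  \<open>s ^ 2\<close>. At 0 both one-sided limits of the difference quotient vanish.\<close>

lemma flat_has_derivative:
  "(flat p has_real_derivative flat ([:0, 0, 1:] * (p - pderiv p)) t) (at t)"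
proof -
  consider "t > 0" | "t < 0" | "t = 0" by linarith
  then show ?thesis
  proof cases
    case 1
    have "((\<lambda>t. poly p (1 / t) * exp (- (1 / t))) has_real_derivative
        flat ([:0, 0, 1:] * (p - pderiv p)) t) (at t)"
      using 1 by (auto intro!: derivative_eq_intros simp: flat_def field_simps power2_eq_square)
    then show ?thesis
      by (rule has_field_derivative_transform_within_open[where S = "{0<..}"])
         (use 1 in \<open>auto simp: flat_def\<close>)
  next
    case 2
    have "((\<lambda>t. 0) has_real_derivative flat ([:0, 0, 1:] * (p - pderiv p)) t) (at t)"
      using 2 by (auto simp: flat_def)
    then show ?thesis
      by (rule has_field_derivative_transform_within_open[where S = "{..<0}"])
         (use 2 in \<open>auto simp: flat_def\<close>)
  next
    case 3
    have "((\<lambda>h. flat p h / h) \<longlongrightarrow> 0) (at_right 0)"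
    proof -
      \<comment> \<open>With \<open>s = 1 / h\<close>, dividing by \<open>h\<close> multiplies by
        \<open>s\<close>, which is what \<open>pCons 0\<close> does to the polynomial.\<close>
      have "((\<lambda>s. poly (pCons 0 p) s * exp (- s)) \<longlongrightarrow> 0) at_top"
        by (rule poly_div_exp_tendsto_0)
      then have "((\<lambda>h. poly (pCons 0 p) (inverse h) * exp (- inverse h)) \<longlongrightarrow> 0) (at_right (0::real))"
        by (rule filterlim_compose) (rule filterlim_inverse_at_top_right)
      then show ?thesis
        by (rule Lim_transform_eventually)
           (auto simp: flat_def field_simps eventually_at_filter)
    qed
    moreover have "((\<lambda>h. flat p h / h) \<longlongrightarrow> 0) (at_left 0)"
      by (rule Lim_transform_eventually[OF tendsto_const[of 0]])
         (auto simp: flat_def eventually_at_filter)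
    ultimately have "((\<lambda>h. flat p h / h) \<longlongrightarrow> 0) (at 0)"
      by (simp add: filterlim_at_split)
    then show ?thesis
      using 3 by (simp add: DERIV_def flat_def)
  qed
qed

lemma diff_n_flat: "diff_n n (flat p)"
  by (induction n arbitrary: p) (auto intro!: exI flat_has_derivative)

text \<open>On the interval from \<open>l\<close> to \<open>u\<close> this is
  \<open>exp (- 1 / (n * (t - l))) * exp (- 1 / (n * (u - t)))\<close> with
  \<open>n = Suc k\<close>, and 0 elsewhere. The support stays fixed while the values tend to the
  indicator of the open interval; \<open>Suc k\<close> keeps the scaling positive.\<close>

definition bump :: "real \<Rightarrow> real \<Rightarrow> nat \<Rightarrow> real \<Rightarrow> real" where
  "bump l u k t = flat 1 (real (Suc k) * t - real (Suc k) * l) * flat 1 (real (Suc k) * u - real (Suc k) * t)"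

lemma smooth1_bump: "smooth1 (bump l u k)"
proof -
  have "diff_n n (\<lambda>t. flat 1 (real (Suc k) * t + (- real (Suc k) * l)) * flat 1 ((- real (Suc k)) * t + real (Suc k) * u))" for n
    by (intro diff_n_mult diff_n_affine diff_n_flat)
  then show ?thesis
    unfolding smooth1_def bump_def by (simp add: algebra_simps)
qed

lemma bump_nonneg: "0 \<le> bump l u k t"
  by (simp add: bump_def flat_def)

lemma bump_le_1: "bump l u k t \<le> 1"
  unfolding bump_def by (rule mult_le_one) (auto simp: flat_def)

lemma bump_eq_0: "t \<notin> {l<..<u} \<Longrightarrow> bump l u k t = 0"
  by (auto simp: bump_def flat_def mult_less_0_iff right_diff_distrib[symmetric] zero_less_mult_iff
      simp del: of_nat_Suc)

lemma bump_tendsto: "(\<lambda>k. bump l u k t) \<longlonglongrightarrow> indicator {l<..<u} t"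
proof (cases "t \<in> {l<..<u}")
  case True
  have "(\<lambda>k. exp (- (1 / (real (Suc k) * (t - l)))) * exp (- (1 / (real (Suc k) * (u - t))))) \<longlonglongrightarrow> 1"
    using True by real_asymp
  moreover have "bump l u k t = exp (- (1 / (real (Suc k) * (t - l)))) * exp (- (1 / (real (Suc k) * (u - t))))" for k
    using True by (simp add: bump_def flat_def right_diff_distrib[symmetric] del: of_nat_Suc)
  ultimately show ?thesis using True by simp
qed (simp add: bump_eq_0)

section \<open>Derivatives and supports of products over the coordinates\<close>

lemma smooth1_deriv:
  assumes "smooth1 h"
  shows "(h has_real_derivative deriv h x) (at x)" "smooth1 (deriv h)"
proof -
  have *: "\<exists>h'. (\<forall>x. (h has_real_derivative h' x) (at x)) \<and> diff_n n h'" for n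
    using assms by (auto simp: smooth1_def dest: spec[of _ "Suc n"])
  then have d: "(h has_real_derivative deriv h x) (at x)" for x
    by (metis DERIV_imp_deriv)
  then show "(h has_real_derivative deriv h x) (at x)" .
  \<comment> \<open>Each level \<open>n\<close> comes with its own witness \<open>h'\<close>;
    uniqueness of derivatives identifies them all with \<open>deriv h\<close>.\<close>
  have "h' = deriv h" if "\<forall>x. (h has_real_derivative h' x) (at x)" for h'
    using that d by (auto intro: DERIV_unique)
  then show "smooth1 (deriv h)" using * unfolding smooth1_def by metis
qed

lemma smooth1_continuous: "smooth1 h \<Longrightarrow> continuous_on S h"
  by (meson DERIV_isCont continuous_at_imp_continuous_on smooth1_deriv(1))

lemma has_derivative_prod_coordinates:
  fixes h :: "'a::euclidean_space \<Rightarrow> real \<Rightarrow> real"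
  assumes "\<And>i. i \<in> Basis \<Longrightarrow> smooth1 (h i)"
  shows "((\<lambda>x. \<Prod>i\<in>Basis. h i (x \<bullet> i)) has_derivative
    (\<lambda>y. \<Sum>i\<in>Basis. (deriv (h i) (x \<bullet> i) * (y \<bullet> i)) * (\<Prod>j\<in>Basis - {i}. h j (x \<bullet> j)))) (at x)"
proof (rule has_derivative_prod)
  fix i :: 'a assume "i \<in> Basis"
  then have "(h i has_derivative (*) (deriv (h i) (x \<bullet> i))) (at (x \<bullet> i))"
    using smooth1_deriv(1)[OF assms] by (simp add: has_field_derivative_def)
  then show "((\<lambda>x. h i (x \<bullet> i)) has_derivative (\<lambda>y. deriv (h i) (x \<bullet> i) * (y \<bullet> i))) (at x)"
    by (rule has_derivative_compose[rotated]) (auto intro!: derivative_eq_intros)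
qed

text \<open>Only the factor in direction \<open>b\<close> depends on \<open>x \<bullet> b\<close>.
  The result is written as a product of the same shape, so that higher smoothness follows by
  induction over all such products.\<close>

lemma frechet_derivative_prod_coordinates:
  fixes h :: "'a::euclidean_space \<Rightarrow> real \<Rightarrow> real"
  assumes "\<And>i. i \<in> Basis \<Longrightarrow> smooth1 (h i)" and b: "b \<in> Basis"
  shows "frechet_derivative (\<lambda>x. \<Prod>i\<in>Basis. h i (x \<bullet> i)) (at x) b =
    (\<Prod>i\<in>Basis. (h(b := deriv (h b))) i (x \<bullet> i))"
proof -
  have "frechet_derivative (\<lambda>x. \<Prod>i\<in>Basis. h i (x \<bullet> i)) (at x) b
      = (\<Sum>i\<in>Basis. (deriv (h i) (x \<bullet> i) * (b \<bullet> i)) * (\<Prod>j\<in>Basis - {i}. h j (x \<bullet> j)))"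
    by (subst frechet_derivative_at[OF has_derivative_prod_coordinates[OF assms(1)], symmetric]) auto
  also have "\<dots> = (\<Sum>i\<in>{b}. (deriv (h i) (x \<bullet> i) * (b \<bullet> i)) * (\<Prod>j\<in>Basis - {i}. h j (x \<bullet> j)))"
    using b by (intro sum.mono_neutral_right) (auto simp: inner_Basis)
  also have "\<dots> = deriv (h b) (x \<bullet> b) * (\<Prod>j\<in>Basis - {b}. h j (x \<bullet> j))"
    using b by (simp add: inner_Basis)
  also have "\<dots> = (\<Prod>i\<in>Basis. (h(b := deriv (h b))) i (x \<bullet> i))"
    using b by (subst prod.remove[of _ b]) auto
  finally show ?thesis .
qed

lemma C_k_prod_coordinates:
  fixes h :: "'a::euclidean_space \<Rightarrow> real \<Rightarrow> real"
  assumes "\<And>i. i \<in> Basis \<Longrightarrow> smooth1 (h i)"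
  shows "C_k k (\<lambda>x. \<Prod>i\<in>Basis. h i (x \<bullet> i))"
  using assms
proof (induction k arbitrary: h)
  case 0
  have "continuous_on UNIV (\<lambda>x::'a. h i (x \<bullet> i))" if "i \<in> Basis" for i
    by (rule continuous_on_compose2[OF smooth1_continuous[of "h i" UNIV]])
       (use 0 that in \<open>auto intro!: continuous_intros\<close>)
  then show ?case by (auto intro!: continuous_on_prod)
next
  case (Suc k)
  have "C_k k (\<lambda>x. \<Prod>i\<in>Basis. (h(b := deriv (h b))) i (x \<bullet> i))" if "b \<in> Basis" for b
    using Suc.prems that by (intro Suc.IH) (auto intro: smooth1_deriv)
  moreover have "(\<lambda>x. \<Prod>i\<in>Basis. h i (x \<bullet> i)) differentiable (at x)" for x
    using has_derivative_prod_coordinates[OF Suc.prems] by (rule differentiableI)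
  ultimately show ?case
    by (auto simp: frechet_derivative_prod_coordinates[OF Suc.prems] simp del: fun_upd_apply)
qed

lemma test_function_prod_coordinates:
  fixes h :: "'a::euclidean_space \<Rightarrow> real \<Rightarrow> real"
  assumes "\<And>i. i \<in> Basis \<Longrightarrow> smooth1 (h i)"
    and "\<And>i t. i \<in> Basis \<Longrightarrow> t \<notin> {l \<bullet> i<..<u \<bullet> i} \<Longrightarrow> h i t = 0"
  shows "test_function (\<lambda>x. \<Prod>i\<in>Basis. h i (x \<bullet> i))"
proof -
  have "{x. (\<Prod>i\<in>Basis. h i (x \<bullet> i)) \<noteq> 0} \<subseteq> cbox l u"
  proof
    fix x assume "x \<in> {x. (\<Prod>i\<in>Basis. h i (x \<bullet> i)) \<noteq> 0}"
    then have "\<forall>i\<in>Basis. h i (x \<bullet> i) \<noteq> 0" by simp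
    then have "\<forall>i\<in>Basis. x \<bullet> i \<in> {l \<bullet> i<..<u \<bullet> i}" using assms(2) by blast
    then show "x \<in> cbox l u" by (auto simp: mem_box less_imp_le)
  qed
  then have "bounded {x. (\<Prod>i\<in>Basis. h i (x \<bullet> i)) \<noteq> 0}"
    using bounded_cbox bounded_subset by blast
  then show ?thesis
    using C_k_prod_coordinates[OF assms(1)]
    by (auto simp: test_function_def compact_eq_bounded_closed bounded_closure)
qed

subsection \<open>Null cylinders\<close>

text \<open>For a basis vector \<open>b\<close> this is the orthogonal projection onto the
  hyperplane \<open>x \<bullet> b = 0\<close>, kept inside the same space; cylinders parallel to
  \<open>b\<close> are its preimages.\<close>

definition drop_coord :: "'a::euclidean_space \<Rightarrow> 'a \<Rightarrow> 'a" where
  "drop_coord b x = x - (x \<bullet> b) *\<^sub>R b"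

lemma drop_coord_measurable [measurable]: "drop_coord b \<in> borel_measurable borel"
  unfolding drop_coord_def by measurable

lemma inner_drop_coord:
  "b \<in> Basis \<Longrightarrow> i \<in> Basis \<Longrightarrow> drop_coord b x \<bullet> i = (if i = b then 0 else x \<bullet> i)"
  by (auto simp: drop_coord_def inner_diff_left inner_Basis)

text \<open>The complement of the closed interval is open, so the bump vanishes on a whole
  neighbourhood of \<open>t\<close>.\<close>

lemma deriv_bump_eq_0: "t \<notin> {l..u} \<Longrightarrow> deriv (bump l u k) t = 0"
proof -
  assume t: "t \<notin> {l..u}"
  have "((\<lambda>t. 0) has_real_derivative 0) (at t)" by simp
  then have "(bump l u k has_real_derivative 0) (at t)"
    by (rule has_field_derivative_transform_within_open[where S = "- {l..u}"])
       (use t in \<open>auto simp: bump_eq_0 open_Compl\<close>)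
  then show ?thesis by (rule DERIV_imp_deriv)
qed

lemma deriv_bump_bounded: obtains M where "\<And>t. \<bar>deriv (bump l u k) t\<bar> \<le> M"
proof -
  have "compact (deriv (bump l u k) ` {l..u})"
    by (intro compact_continuous_image smooth1_continuous smooth1_deriv smooth1_bump compact_Icc)
  then have "bounded (deriv (bump l u k) ` {l..u})" by (rule compact_imp_bounded)
  then obtain M where M: "\<forall>t\<in>{l..u}. \<bar>deriv (bump l u k) t\<bar> \<le> M" by (auto simp: bounded_iff)
  have "\<bar>deriv (bump l u k) t\<bar> \<le> max M 0" for t
    using M by (cases "t \<in> {l..u}") (auto simp: deriv_bump_eq_0 le_max_iff_disj)
  then show ?thesis using that by blast
qed

lemma bump_measurable [measurable]:
  "bump l u k \<in> borel_measurable borel" "deriv (bump l u k) \<in> borel_measurable borel"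
  by (intro borel_measurable_continuous_onI smooth1_continuous smooth1_deriv smooth1_bump)+

context
  fixes u :: "'a::euclidean_space \<Rightarrow> real" and \<nu> :: "'a set \<Rightarrow> real" and b :: 'a
  assumes b: "b \<in> Basis" and \<nu>: "vector_measure \<nu>" and u: "locally_integrable u"
    and parts: "\<And>\<phi>. test_function \<phi> \<Longrightarrow>
      integral\<^sup>L lebesgue (\<lambda>x. u x * frechet_derivative \<phi> (at x) b) = - signed_integral \<nu> \<phi>"
begin

text \<open>Integration by parts moves the derivative only onto the factor in the direction \<open>b\<close>; the
  other factors may therefore tend to indicator functions.\<close>

private lemma integral_cylinder_box:
  "(\<integral>x. indicator (box l r) (drop_coord b x) * bump a c m (x \<bullet> b) \<partial>positive_part \<nu>)
    - (\<integral>x. indicator (box l r) (drop_coord b x) * bump a c m (x \<bullet> b) \<partial>positive_part (\<lambda>A. - \<nu> A))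
    = - (\<integral>x. indicator (box l r) (drop_coord b x) * (u x * deriv (bump a c m) (x \<bullet> b)) \<partial>lebesgue)"
proof (cases "0 \<in> {l \<bullet> b<..<r \<bullet> b}")
  \<comment> \<open>The projected point has coordinate 0 in direction \<open>b\<close>, so in this
    case the cylinder is empty and all integrals are 0.\<close>
  case False
  have "drop_coord b x \<notin> box l r" for x
    using False b inner_drop_coord[OF b b, of x] by (force simp: mem_box)
  then show ?thesis by simp
next
  case True
  \<comment> \<open>\<open>Q k\<close> is the smooth cross-section factor, \<open>I\<close> its
    limit, and \<open>\<beta>\<close> the fixed factor in direction \<open>b\<close>.\<close>
  define Q where "Q k x = (\<Prod>i\<in>Basis - {b}. bump (l \<bullet> i) (r \<bullet> i) k (x \<bullet> i))" for k and x :: 'a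
  define I where "I x = (indicator (box l r) (drop_coord b x) :: real)" for x
  define h where "h k i = (if i = b then bump a c m else bump (l \<bullet> i) (r \<bullet> i) k)" for k i
  define \<phi> where "\<phi> k x = (\<Prod>i\<in>Basis. h k i (x \<bullet> i))" for k x
  define \<beta> where "\<beta> = bump a c m"
  define \<beta>' where "\<beta>' = deriv \<beta>"
  let ?P = "positive_part \<nu>" and ?N = "positive_part (\<lambda>A. - \<nu> A)"
  have [measurable]: "\<beta> \<in> borel_measurable borel" "\<beta>' \<in> borel_measurable borel"
    unfolding \<beta>_def \<beta>'_def by measurable
  have [measurable]: "Q k \<in> borel_measurable borel" for k
    unfolding Q_def by measurable
  have [measurable]: "I \<in> borel_measurable borel"
    unfolding I_def by measurable
  have I_prod: "I x = (\<Prod>i\<in>Basis - {b}. indicator {l \<bullet> i<..<r \<bullet> i} (x \<bullet> i))" for x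
  proof (cases "drop_coord b x \<in> box l r")
    case T: True
    then have "\<forall>i\<in>Basis - {b}. x \<bullet> i \<in> {l \<bullet> i<..<r \<bullet> i}"
      by (auto simp: mem_box inner_drop_coord[OF b])
    then show ?thesis using T by (simp add: I_def)
  next
    case F: False
    then obtain i where i: "i \<in> Basis" "drop_coord b x \<bullet> i \<notin> {l \<bullet> i<..<r \<bullet> i}"
      by (auto simp: mem_box)
    with True have "i \<noteq> b" by (auto simp: inner_drop_coord[OF b b])
    then have "(\<Prod>i\<in>Basis - {b}. indicator {l \<bullet> i<..<r \<bullet> i} (x \<bullet> i)) = (0::real)"
      using i by (intro prod_zero) (auto intro!: bexI[of _ i] simp: inner_drop_coord[OF b])
    then show ?thesis using F by (simp add: I_def)
  qed
  have lim: "(\<lambda>k. Q k x) \<longlonglongrightarrow> I x" for x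
    unfolding Q_def I_prod by (intro tendsto_prod bump_tendsto)
  have Q01: "0 \<le> Q k x" "Q k x \<le> 1" for k x
    unfolding Q_def by (auto intro!: prod_nonneg prod_le_1 bump_nonneg bump_le_1)
  have \<beta>01: "0 \<le> \<beta> t" "\<beta> t \<le> 1" for t
    unfolding \<beta>_def by (auto intro!: bump_nonneg bump_le_1)
  obtain M where M: "\<And>t. \<bar>\<beta>' t\<bar> \<le> M"
    unfolding \<beta>'_def \<beta>_def using deriv_bump_bounded by blast
  have smooth: "smooth1 (h k i)" for k i
    by (simp add: h_def smooth1_bump)
  have \<phi>_eq: "\<phi> k x = Q k x * \<beta> (x \<bullet> b)" for k x
    unfolding \<phi>_def using b
    by (subst prod.remove[of _ b]) (auto simp: h_def Q_def \<beta>_def intro!: prod.cong)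
  have d\<phi>: "frechet_derivative (\<phi> k) (at x) b = Q k x * \<beta>' (x \<bullet> b)" for k x
  proof -
    have "frechet_derivative (\<phi> k) (at x) b = (\<Prod>i\<in>Basis. ((h k)(b := deriv (h k b))) i (x \<bullet> i))"
      unfolding \<phi>_def by (rule frechet_derivative_prod_coordinates[OF smooth b])
    also have "\<dots> = Q k x * \<beta>' (x \<bullet> b)"
      using b
      by (subst prod.remove[of _ b]) (auto simp: h_def Q_def \<beta>_def \<beta>'_def intro!: prod.cong)
    finally show ?thesis .
  qed
  \<comment> \<open>These corners replace the extent of the box in direction \<open>b\<close> by the
    interval from \<open>a\<close> to \<open>c\<close>; the resulting closed box contains the
    supports for all \<open>k\<close>.\<close>
  define l' where "l' = l + (a - l \<bullet> b) *\<^sub>R b"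
  define r' where "r' = r + (c - r \<bullet> b) *\<^sub>R b"
  have l': "l' \<bullet> i = (if i = b then a else l \<bullet> i)" and r': "r' \<bullet> i = (if i = b then c else r \<bullet> i)"
    if "i \<in> Basis" for i
    using b that by (auto simp: l'_def r'_def inner_add_left inner_Basis)
  have test: "test_function (\<phi> k)" for k
    unfolding \<phi>_def
    by (rule test_function_prod_coordinates[OF smooth, of l' r'])
       (auto simp: l' r' h_def bump_eq_0)
  define K where "K = cbox l' r'"
  have zero: "Q k x * \<beta>' (x \<bullet> b) = 0" if "x \<notin> K" for k x
  proof -
    obtain i where i: "i \<in> Basis" "x \<bullet> i \<notin> {l' \<bullet> i..r' \<bullet> i}"
      using \<open>x \<notin> K\<close> by (auto simp: K_def mem_box)
    show ?thesis
    proof (cases "i = b")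
      case True
      then have "\<beta>' (x \<bullet> b) = 0"
        using i l' r' unfolding \<beta>'_def \<beta>_def by (intro deriv_bump_eq_0) auto
      then show ?thesis by simp
    next
      case False
      then have "bump (l \<bullet> i) (r \<bullet> i) k (x \<bullet> i) = 0"
        using i l' r' by (intro bump_eq_0) auto
      then have "Q k x = 0"
        unfolding Q_def using i False by (intro prod_zero) auto
      then show ?thesis by simp
    qed
  qed
  have intK: "integrable lebesgue (\<lambda>x. indicator K x * u x)"
    using u by (simp add: locally_integrable_def K_def set_integrable_def)
  note measK [measurable] = borel_measurable_integrable[OF intK]
  \<comment> \<open>\<open>u\<close> is only locally integrable, so a dominating function
    independent of \<open>k\<close> requires a cutoff to the compact set \<open>K\<close>.\<close>
  have uQ: "u x * (Q k x * \<beta>' (x \<bullet> b)) = (indicator K x * u x) * (Q k x * \<beta>' (x \<bullet> b))" for k x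
    using zero[of x k] by (cases "x \<in> K") auto
  \<comment> \<open>The two sequences coincide by \<open>uQ\<close>; equality of their limits gives
    the same cutoff for \<open>I\<close>.\<close>
  have "(\<lambda>k. u x * (Q k x * \<beta>' (x \<bullet> b))) \<longlonglongrightarrow> u x * (I x * \<beta>' (x \<bullet> b))" for x
    by (intro tendsto_intros lim)
  moreover have "(\<lambda>k. (indicator K x * u x) * (Q k x * \<beta>' (x \<bullet> b)))
      \<longlonglongrightarrow> (indicator K x * u x) * (I x * \<beta>' (x \<bullet> b))" for x
    by (intro tendsto_intros lim)
  ultimately have uI: "u x * (I x * \<beta>' (x \<bullet> b)) = (indicator K x * u x) * (I x * \<beta>' (x \<bullet> b))" for x
    unfolding uQ using LIMSEQ_unique by blast
  have 1: "(\<lambda>k. \<integral>x. u x * (Q k x * \<beta>' (x \<bullet> b)) \<partial>lebesgue)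
      \<longlonglongrightarrow> (\<integral>x. u x * (I x * \<beta>' (x \<bullet> b)) \<partial>lebesgue)"
    unfolding uQ uI
  proof (rule integral_dominated_convergence[where w = "\<lambda>x. \<bar>indicator K x * u x\<bar> * M"])
    show "integrable lebesgue (\<lambda>x. \<bar>indicator K x * u x\<bar> * M)"
      using intK by (intro integrable_mult_left integrable_abs)
    have Qm: "(\<lambda>x. Q k x * \<beta>' (x \<bullet> b)) \<in> borel_measurable lebesgue" for k
      by (rule measurable_completion) measurable
    have Im: "(\<lambda>x. I x * \<beta>' (x \<bullet> b)) \<in> borel_measurable lebesgue"
      by (rule measurable_completion) measurable
    show "(\<lambda>x. (indicator K x * u x) * (Q k x * \<beta>' (x \<bullet> b))) \<in> borel_measurable lebesgue" for k
      by (intro borel_measurable_times measK Qm)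
    show "(\<lambda>x. (indicator K x * u x) * (I x * \<beta>' (x \<bullet> b))) \<in> borel_measurable lebesgue"
      by (intro borel_measurable_times measK Im)
    have "\<bar>Q k x * \<beta>' (x \<bullet> b)\<bar> \<le> 1 * M" for k x
      unfolding abs_mult using Q01[of k x] M by (intro mult_mono) auto
    then show "AE x in lebesgue. norm ((indicator K x * u x) * (Q k x * \<beta>' (x \<bullet> b))) \<le> \<bar>indicator K x * u x\<bar> * M" for k
      unfolding real_norm_def abs_mult[of "indicator K _ * u _"] by (intro AE_I2 mult_left_mono) auto
  qed (intro AE_I2 tendsto_intros lim)
  have 2: "(\<lambda>k. \<integral>x. Q k x * \<beta> (x \<bullet> b) \<partial>positive_part \<rho>) \<longlonglongrightarrow> (\<integral>x. I x * \<beta> (x \<bullet> b) \<partial>positive_part \<rho>)"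
    if \<rho>: "vector_measure \<rho>" for \<rho> :: "'a set \<Rightarrow> real"
  proof (rule integral_dominated_convergence[where w = "\<lambda>x. 1"])
    interpret finite_measure "positive_part \<rho>" by (rule finite_measure_positive_part[OF \<rho>])
    show "integrable (positive_part \<rho>) (\<lambda>x. 1 :: real)" by simp
    have "\<bar>Q k x * \<beta> (x \<bullet> b)\<bar> \<le> 1 * 1" for k x
      unfolding abs_mult using Q01[of k x] \<beta>01 by (intro mult_mono) auto
    then show "AE x in positive_part \<rho>. norm (Q k x * \<beta> (x \<bullet> b)) \<le> 1" for k
      by (intro AE_I2) auto
  qed (measurable, intro AE_I2 tendsto_intros lim)
  have "(\<integral>x. u x * (Q k x * \<beta>' (x \<bullet> b)) \<partial>lebesgue)
      = - ((\<integral>x. Q k x * \<beta> (x \<bullet> b) \<partial>?P) - (\<integral>x. Q k x * \<beta> (x \<bullet> b) \<partial>?N))" for k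
    using parts[OF test[of k]] unfolding d\<phi> signed_integral_def unfolding \<phi>_eq .
  then have "(\<lambda>k. \<integral>x. u x * (Q k x * \<beta>' (x \<bullet> b)) \<partial>lebesgue)
      \<longlonglongrightarrow> - ((\<integral>x. I x * \<beta> (x \<bullet> b) \<partial>?P) - (\<integral>x. I x * \<beta> (x \<bullet> b) \<partial>?N))"
    using 2[OF \<nu>] 2[OF vector_measure_uminus[OF \<nu>]] by (auto intro!: tendsto_intros)
  with 1 have "(\<integral>x. u x * (I x * \<beta>' (x \<bullet> b)) \<partial>lebesgue)
      = - ((\<integral>x. I x * \<beta> (x \<bullet> b) \<partial>?P) - (\<integral>x. I x * \<beta> (x \<bullet> b) \<partial>?N))"
    by (rule LIMSEQ_unique)
  then show ?thesis
    unfolding I_def \<beta>'_def \<beta>_def by (simp add: mult.left_commute)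
qed

text \<open>The cross section is bounded by the box and the height by the support of the bump, so
  the integrand lives on a compact box, where \<open>u\<close> is integrable and the other factors
  are bounded.\<close>

private lemma integrable_cylinder_box:
  "integrable lebesgue (\<lambda>x. indicator (box l r) (drop_coord b x) * (u x * deriv (bump a c m) (x \<bullet> b)))"
proof -
  define K where "K = cbox (l + (a - l \<bullet> b) *\<^sub>R b) (r + (c - r \<bullet> b) *\<^sub>R b)"
  define g where "g x = indicator (box l r) (drop_coord b x) * deriv (bump a c m) (x \<bullet> b)" for x
  obtain M where M: "\<And>t. \<bar>deriv (bump a c m) t\<bar> \<le> M"
    using deriv_bump_bounded by blast
  have zero: "x \<in> K" if "g x \<noteq> 0" for x
  proof -
    have x: "drop_coord b x \<in> box l r" "x \<bullet> b \<in> {a..c}"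
      using that deriv_bump_eq_0 unfolding g_def by (auto simp: indicator_def split: if_splits)
    have "(l + (a - l \<bullet> b) *\<^sub>R b) \<bullet> i \<le> x \<bullet> i \<and> x \<bullet> i \<le> (r + (c - r \<bullet> b) *\<^sub>R b) \<bullet> i"
      if i: "i \<in> Basis" for i
      using x i b inner_drop_coord[OF b i, of x]
      by (cases "i = b") (auto simp: mem_box inner_add_left inner_Basis less_imp_le)
    then show ?thesis by (simp add: K_def mem_box)
  qed
  have intK: "integrable lebesgue (\<lambda>x. indicator K x * u x)"
    using u by (simp add: locally_integrable_def K_def set_integrable_def)
  have "integrable lebesgue (\<lambda>x. (indicator K x * u x) * g x)"
  proof (rule Bochner_Integration.integrable_bound)
    show "integrable lebesgue (\<lambda>x. (indicator K x * u x) * M)"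
      using intK by (rule integrable_mult_left)
    have "g \<in> borel_measurable lebesgue"
      unfolding g_def by (rule measurable_completion) measurable
    then show "(\<lambda>x. (indicator K x * u x) * g x) \<in> borel_measurable lebesgue"
      by (intro borel_measurable_times borel_measurable_integrable[OF intK])
    have "\<bar>g x\<bar> \<le> \<bar>M\<bar>" for x
      using M[of "x \<bullet> b"] by (auto simp: g_def indicator_def)
    then show "AE x in lebesgue. norm ((indicator K x * u x) * g x) \<le> norm ((indicator K x * u x) * M)"
      unfolding real_norm_def abs_mult[of "indicator K _ * u _"] by (intro AE_I2 mult_left_mono) auto
  qed
  moreover have "(indicator K x * u x) * g x
      = indicator (box l r) (drop_coord b x) * (u x * deriv (bump a c m) (x \<bullet> b))" for x
    using zero[of x] by (cases "g x = 0") (auto simp: g_def)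
  ultimately show ?thesis by simp
qed

text \<open>The integration by parts identity, known for boxes as cross sections, extends to all
  Borel cross sections because its terms are measures. Over a null cylinder the Lebesgue term
  vanishes, so both parts of \<open>\<nu>\<close> give the bump the same integral; sharpening the
  bump yields the slab.\<close>

private lemma null_cylinder_slab:
  assumes T: "T \<in> sets borel" and null: "emeasure lborel (drop_coord b -` T) = 0"
  shows "\<nu> (drop_coord b -` T \<inter> {x. a < x \<bullet> b \<and> x \<bullet> b < c}) = 0"
proof -
  let ?P = "positive_part \<nu>" and ?N = "positive_part (\<lambda>A. - \<nu> A)"
  let ?C = "drop_coord b -` T \<inter> {x. a < x \<bullet> b \<and> x \<bullet> b < c}"
  note \<nu>' = vector_measure_uminus[OF \<nu>]
  note [measurable] = T
  define B :: "nat \<Rightarrow> 'a set" where "B k = box (- real k *\<^sub>R One) (real k *\<^sub>R One)" for k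
  \<comment> \<open>One index enlarges the cube \<open>B k\<close> and sharpens the bump together.
    The cube bounds the cross section and thereby makes the density \<open>w k\<close> integrable on
    the whole space.\<close>
  define p where "p k x = indicator (B k) (drop_coord b x) * bump a c k (x \<bullet> b)" for k x
  define w where "w k x = indicator (B k) (drop_coord b x) * (u x * deriv (bump a c k) (x \<bullet> b))" for k x
  have [measurable]: "B k \<in> sets borel" for k by (simp add: B_def)
  have [measurable]: "p k \<in> borel_measurable borel" for k
    unfolding p_def by measurable
  have p01: "\<bar>p k x\<bar> \<le> 1" for k x
    by (auto simp: p_def indicator_def bump_nonneg bump_le_1)
  have p_int: "integrable (positive_part \<rho>) (p k)"
    if \<rho>: "vector_measure \<rho>" for \<rho> :: "'a set \<Rightarrow> real" and k
  proof -
    interpret finite_measure "positive_part \<rho>" by (rule finite_measure_positive_part[OF \<rho>])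
    show ?thesis
      by (rule integrable_const_bound[of _ 1]) (auto simp: p01)
  qed
  have w_int: "integrable lebesgue (w k)" for k
    unfolding w_def B_def by (rule integrable_cylinder_box)
  have eq: "(\<integral>x. indicator T (drop_coord b x) * p k x \<partial>?P)
      = (\<integral>x. indicator T (drop_coord b x) * p k x \<partial>?N)" for k
  proof -
    \<comment> \<open>The defect in the integration by parts identity, as a set function of the
      cross section.\<close>
    define \<rho> where "\<rho> T = (\<integral>x. indicator T (drop_coord b x) * p k x \<partial>?P)
      + - (\<integral>x. indicator T (drop_coord b x) * p k x \<partial>?N)
      + (\<integral>x. indicator T (drop_coord b x) * w k x \<partial>lebesgue)" for T
    have "\<rho> T = 0"
    proof (rule vector_measure_eq_0[OF _ _ T])
      show "vector_measure \<rho>"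
        unfolding \<rho>_def
        by (intro vector_measure_add vector_measure_uminus vector_measure_integral p_int \<nu> \<nu>' w_int
            measurable_completion) measurable
      fix l r :: 'a
      \<comment> \<open>The cutoff cube meets a box in a box, which brings the defect on boxes back
        to \<open>integral_cylinder_box\<close>.\<close>
      obtain l' r' where lr: "box l r \<inter> B k = box l' r'"
        unfolding B_def box_Int_box by blast
      have ind: "indicator (box l r) y * (indicator (B k) y * z) = indicator (box l' r') y * (z :: real)" for y z
        unfolding lr[symmetric] by (simp add: indicator_inter_arith)
      show "\<rho> (box l r) = 0"
        unfolding \<rho>_def p_def w_def ind using integral_cylinder_box[of l' r' a c k] by simp
    qed
    moreover have "(\<integral>x. indicator T (drop_coord b x) * w k x \<partial>lebesgue) = 0"
    proof (rule integral_eq_zero_AE)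
      have "drop_coord b -` T \<in> null_sets lebesgue"
        using null measurable_sets[OF drop_coord_measurable T]
        by (intro null_sets_completionI) (auto simp: null_sets_def)
      then have "AE x in lebesgue. x \<notin> drop_coord b -` T" by (rule AE_not_in)
      then show "AE x in lebesgue. indicator T (drop_coord b x) * w k x = 0"
        by eventually_elim auto
    qed
    ultimately show ?thesis by (simp add: \<rho>_def)
  qed
  have lim: "(\<lambda>k. \<integral>x. indicator T (drop_coord b x) * p k x \<partial>positive_part \<rho>)
      \<longlonglongrightarrow> measure (positive_part \<rho>) ?C"
    if \<rho>: "vector_measure \<rho>" for \<rho> :: "'a set \<Rightarrow> real"
  proof -
    interpret finite_measure "positive_part \<rho>" by (rule finite_measure_positive_part[OF \<rho>])
    have B1: "\<forall>\<^sub>F k in sequentially. indicator (B k) y = (1::real)" for y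
    proof -
      obtain n where n: "norm y < real n" using reals_Archimedean2 by blast
      have "y \<in> B k" if "k \<ge> n" for k
      proof -
        have "norm y < real k" using n that by simp
        then have "\<forall>i\<in>Basis. \<bar>y \<bullet> i\<bar> < real k" by (meson Basis_le_norm le_less_trans)
        then show ?thesis by (auto simp: B_def mem_box abs_less_iff)
      qed
      then show ?thesis by (auto simp: eventually_sequentially intro!: exI[of _ n])
    qed
    have "(\<lambda>k. p k x) \<longlonglongrightarrow> 1 * indicator {a<..<c} (x \<bullet> b)" for x
      unfolding p_def by (intro tendsto_mult bump_tendsto tendsto_eventually B1)
    then have "(\<lambda>k. indicator T (drop_coord b x) * p k x)
        \<longlonglongrightarrow> indicator T (drop_coord b x) * indicator {a<..<c} (x \<bullet> b)" for x
      by (intro tendsto_mult tendsto_const) simp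
    moreover have "indicator T (drop_coord b x) * indicator {a<..<c} (x \<bullet> b) = (indicator ?C x :: real)" for x
      by (auto simp: indicator_def)
    ultimately have "(\<lambda>k. indicator T (drop_coord b x) * p k x) \<longlonglongrightarrow> indicator ?C x" for x
      by simp
    moreover have C [measurable]: "?C \<in> sets borel"
      using measurable_sets[OF drop_coord_measurable T] by measurable
    ultimately have "(\<lambda>k. \<integral>x. indicator T (drop_coord b x) * p k x \<partial>positive_part \<rho>)
      \<longlonglongrightarrow> (\<integral>x. indicator ?C x \<partial>positive_part \<rho>)"
      by (intro integral_dominated_convergence[where w = "\<lambda>x. 1"])
         (auto simp: abs_mult indicator_def p01)
    then show ?thesis using C by simp
  qed
  have "measure ?P ?C = measure ?N ?C"
    using LIMSEQ_unique[OF lim[OF \<nu>]] lim[OF \<nu>'] by (simp add: eq)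
  moreover have "?C \<in> sets borel"
    using measurable_sets[OF drop_coord_measurable T] by measurable
  ultimately show ?thesis
    using measure_positive_part_uminus[OF \<nu>] by simp
qed

text \<open>That \<open>\<nu>\<close> vanishes on the cylinder would allow cancellation; it must
  vanish on every Borel subset. Intersecting the cylinder with a box gives a slab over a smaller
  null cylinder, so the restriction of \<open>\<nu>\<close> vanishes on boxes and hence
  everywhere.\<close>

lemma measure_positive_part_null_cylinder:
  assumes T: "T \<in> sets borel" and null: "emeasure lborel (drop_coord b -` T) = 0"
  shows "measure (positive_part \<nu>) (drop_coord b -` T) = 0"
proof -
  let ?S = "drop_coord b -` T"
  have S: "?S \<in> sets borel" using measurable_sets[OF drop_coord_measurable T] by simp
  have zero: "\<nu> (?S \<inter> A) = 0" if "A \<in> sets borel" for A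
  proof (rule vector_measure_eq_0[OF vector_measure_restrict[OF \<nu> S] _ that])
    fix l r :: 'a
    \<comment> \<open>The constraints of the box in all directions but \<open>b\<close>; the
      remaining one is the slab.\<close>
    let ?U = "{y. \<forall>i\<in>Basis - {b}. l \<bullet> i < y \<bullet> i \<and> y \<bullet> i < r \<bullet> i}"
    have U: "?U \<in> sets borel" by measurable
    have "emeasure lborel (drop_coord b -` (T \<inter> ?U)) \<le> emeasure lborel ?S"
      using S by (intro emeasure_mono) auto
    then have "emeasure lborel (drop_coord b -` (T \<inter> ?U)) = 0" using null by simp
    then have "\<nu> (drop_coord b -` (T \<inter> ?U) \<inter> {x. l \<bullet> b < x \<bullet> b \<and> x \<bullet> b < r \<bullet> b}) = 0"
      using T U by (intro null_cylinder_slab) auto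
    moreover have "drop_coord b -` (T \<inter> ?U) \<inter> {x. l \<bullet> b < x \<bullet> b \<and> x \<bullet> b < r \<bullet> b} = ?S \<inter> box l r"
      using b by (auto simp: mem_box inner_drop_coord)
    ultimately show "\<nu> (?S \<inter> box l r) = 0" by simp
  qed
  have "\<nu> E \<le> 0" if "E \<in> sets borel" "E \<subseteq> ?S" for E
    using zero[OF that(1)] that(2) by (simp add: inf.absorb2)
  then have "measure (positive_part \<nu>) ?S \<le> 0"
    by (intro measure_positive_part_le[OF \<nu> S])
  then show ?thesis by (simp add: measure_le_0_iff)
qed

end

subsection \<open>Hausdorff measure and cylinders\<close>

text \<open>A covering set of diameter \<open>D\<close> projects into a cube with half-side
  \<open>D\<close>. With \<open>d = DIM('a) - 1\<close> and \<open>v\<close> the volume of the unit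
  ball in dimension \<open>d\<close>, the cylinder over it, cut at height \<open>m\<close>, has
  volume at most \<open>2 * m * (2 * D) ^ d = (2 * m * 4 ^ d / v) * (v * (D / 2) ^ d)\<close>, a
  multiple of its term in the Hausdorff sum.\<close>

lemma hausdorff_measure_cylinder_cover:
  fixes b :: "'a::euclidean_space"
  assumes b: "b \<in> Basis" and B: "hausdorff_measure (DIM('a) - 1) B < ennreal \<delta>"
  obtains T where "T \<in> sets borel" "B \<subseteq> drop_coord b -` T"
    "\<And>m. m \<ge> 0 \<Longrightarrow> emeasure lborel (drop_coord b -` T \<inter> {x. \<bar>x \<bullet> b\<bar> \<le> m})
       \<le> ennreal (2 * m * 4 ^ (DIM('a) - 1) / unit_ball_vol (real (DIM('a) - 1)) * \<delta>)"
proof -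
  define d where "d = DIM('a) - 1"
  define v where "v = unit_ball_vol (real d)"
  have "v > 0" by (simp add: v_def)
  \<comment> \<open>The scale 1 is an arbitrary choice: the volume estimate holds for covering sets
    of any diameter.\<close>
  have "hausdorff_premeasure d 1 B \<le> hausdorff_measure d B"
    unfolding hausdorff_measure_def by (intro SUP_upper) auto
  with B have "hausdorff_premeasure d 1 B < ennreal \<delta>" by (simp add: d_def)
  then obtain C :: "nat \<Rightarrow> 'a set" where C: "B \<subseteq> (\<Union>i. C i)" "\<And>i. bounded (C i)"
    and sum: "(\<Sum>i. if C i = {} then 0 else ennreal (v * (diameter (C i) / 2) ^ d)) < ennreal \<delta>"
    unfolding hausdorff_premeasure_def INF_less_iff v_def by auto
  have "\<delta> > 0" using sum by (cases "\<delta> > 0") (auto simp: ennreal_neg)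
  define c where "c i = (SOME x. x \<in> C i)" for i
  have c: "c i \<in> C i" if "C i \<noteq> {}" for i
    using that unfolding c_def by (simp add: some_in_eq)
  \<comment> \<open>An empty \<open>C i\<close> contributes 0 to the sum, also for
    \<open>d = 0\<close>, where the cylinder over a degenerate cube could still have positive
    volume; hence the case distinction.\<close>
  define T where "T i = (if C i = {} then {} else
    cbox (drop_coord b (c i) - diameter (C i) *\<^sub>R One) (drop_coord b (c i) + diameter (C i) *\<^sub>R One))" for i
  have diam: "0 \<le> diameter (C i)" for i by (rule diameter_ge_0[OF C(2)])
  have T: "T i \<in> sets borel" for i by (simp add: T_def)
  have preT: "drop_coord b -` T i \<in> sets borel" for i
    using measurable_sets[OF drop_coord_measurable T] by simp
  have CT: "C i \<subseteq> drop_coord b -` T i" for i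
  proof
    fix x assume x: "x \<in> C i"
    then have ne: "C i \<noteq> {}" by auto
    have "\<bar>drop_coord b x \<bullet> j - drop_coord b (c i) \<bullet> j\<bar> \<le> diameter (C i)" if j: "j \<in> Basis" for j
    proof -
      have "\<bar>drop_coord b x \<bullet> j - drop_coord b (c i) \<bullet> j\<bar> \<le> \<bar>(x - c i) \<bullet> j\<bar>"
        by (auto simp: inner_drop_coord[OF b j] inner_diff_left)
      also have "\<dots> \<le> dist x (c i)" unfolding dist_norm by (rule Basis_le_norm[OF j])
      also have "\<dots> \<le> diameter (C i)"
        by (rule diameter_bounded_bound[OF C(2) x c[OF ne]])
      finally show ?thesis .
    qed
    then have "drop_coord b x \<in> T i"
      using ne by (auto simp: T_def mem_box inner_diff_left inner_add_left abs_le_iff algebra_simps)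
    then show "x \<in> drop_coord b -` T i" by simp
  qed
  have vol: "emeasure lborel (drop_coord b -` T i \<inter> {x. \<bar>x \<bullet> b\<bar> \<le> m})
      \<le> ennreal (2 * m * 4 ^ d / v) * (if C i = {} then 0 else ennreal (v * (diameter (C i) / 2) ^ d))"
    if m: "m \<ge> 0" for i m
  proof (cases "C i = {}")
    case False
    define D where "D = diameter (C i)"
    have "D \<ge> 0" using diam by (simp add: D_def)
    \<comment> \<open>The cube around \<open>c i\<close>, with its extent in direction
      \<open>b\<close> replaced by the interval from \<open>- m\<close> to \<open>m\<close>.\<close>
    define l where "l = (c i - D *\<^sub>R One) - (m + (c i - D *\<^sub>R One) \<bullet> b) *\<^sub>R b"
    define r where "r = (c i + D *\<^sub>R One) + (m - (c i + D *\<^sub>R One) \<bullet> b) *\<^sub>R b"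
    have l: "l \<bullet> j = (if j = b then - m else c i \<bullet> j - D)" if "j \<in> Basis" for j
      using that b by (auto simp: l_def inner_diff_left inner_add_left inner_Basis)
    have r: "r \<bullet> j = (if j = b then m else c i \<bullet> j + D)" if "j \<in> Basis" for j
      using that b by (auto simp: r_def inner_diff_left inner_add_left inner_Basis)
    have "drop_coord b -` T i \<inter> {x. \<bar>x \<bullet> b\<bar> \<le> m} \<subseteq> cbox l r"
    proof
      fix x assume x: "x \<in> drop_coord b -` T i \<inter> {x. \<bar>x \<bullet> b\<bar> \<le> m}"
      have "l \<bullet> j \<le> x \<bullet> j \<and> x \<bullet> j \<le> r \<bullet> j" if j: "j \<in> Basis" for j
        using x False inner_drop_coord[OF b j] j
        by (cases "j = b")
           (auto simp: l r T_def mem_box inner_diff_left inner_add_left abs_le_iff D_def)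
      then show "x \<in> cbox l r" by (simp add: mem_box)
    qed
    then have "emeasure lborel (drop_coord b -` T i \<inter> {x. \<bar>x \<bullet> b\<bar> \<le> m}) \<le> emeasure lborel (cbox l r)"
      by (rule emeasure_mono) simp
    also have "\<dots> = ennreal (\<Prod>j\<in>Basis. (r - l) \<bullet> j)"
      using m \<open>D \<ge> 0\<close> by (intro emeasure_lborel_cbox) (auto simp: l r)
    also have "(\<Prod>j\<in>Basis. (r - l) \<bullet> j) = 2 * m * (\<Prod>j\<in>Basis - {b}. 2 * D)"
      using b by (subst prod.remove[of _ b]) (auto simp: inner_diff_left l r intro!: prod.cong)
    also have "\<dots> = (2 * m * 4 ^ d / v) * (v * (D / 2) ^ d)"
      using b \<open>v > 0\<close> power_mult_distrib[of 4 "D / 2" d]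
      by (simp add: d_def card_Diff_singleton)
    also have "ennreal \<dots> = ennreal (2 * m * 4 ^ d / v) * ennreal (v * (D / 2) ^ d)"
      using \<open>v > 0\<close> \<open>D \<ge> 0\<close> m by (intro ennreal_mult) auto
    finally show ?thesis using False by (simp add: D_def)
  qed (simp add: T_def)
  show ?thesis
  proof (rule that)
    show "(\<Union>i. T i) \<in> sets borel" using T by auto
    show "B \<subseteq> drop_coord b -` (\<Union>i. T i)" using C(1) CT by fastforce
    fix m :: real assume m: "m \<ge> 0"
    have "emeasure lborel (drop_coord b -` (\<Union>i. T i) \<inter> {x. \<bar>x \<bullet> b\<bar> \<le> m})
        = emeasure lborel (\<Union>i. drop_coord b -` T i \<inter> {x. \<bar>x \<bullet> b\<bar> \<le> m})"
      by (rule arg_cong[where f = "emeasure lborel"]) auto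
    also have "\<dots> \<le> (\<Sum>i. emeasure lborel (drop_coord b -` T i \<inter> {x. \<bar>x \<bullet> b\<bar> \<le> m}))"
    proof (rule emeasure_subadditive_countably)
      have "{x::'a. \<bar>x \<bullet> b\<bar> \<le> m} \<in> sets borel" by measurable
      then show "range (\<lambda>i. drop_coord b -` T i \<inter> {x. \<bar>x \<bullet> b\<bar> \<le> m}) \<subseteq> sets lborel"
        using preT by auto
    qed
    also have "\<dots> \<le> (\<Sum>i. ennreal (2 * m * 4 ^ d / v) *
        (if C i = {} then 0 else ennreal (v * (diameter (C i) / 2) ^ d)))"
      by (intro suminf_le vol m) auto
    also have "\<dots> = ennreal (2 * m * 4 ^ d / v) *
        (\<Sum>i. if C i = {} then 0 else ennreal (v * (diameter (C i) / 2) ^ d))"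
      by (rule ennreal_suminf_cmult)
    also have "\<dots> \<le> ennreal (2 * m * 4 ^ d / v) * ennreal \<delta>"
      using sum by (intro mult_left_mono) auto
    also have "\<dots> = ennreal (2 * m * 4 ^ d / v * \<delta>)"
      using \<open>v > 0\<close> m \<open>\<delta> > 0\<close> by (intro ennreal_mult[symmetric]) auto
    finally show "emeasure lborel (drop_coord b -` (\<Union>i. T i) \<inter> {x. \<bar>x \<bullet> b\<bar> \<le> m})
       \<le> ennreal (2 * m * 4 ^ (DIM('a) - 1) / unit_ball_vol (real (DIM('a) - 1)) * \<delta>)"
      unfolding d_def v_def .
  qed
qed

section \<open>Absolute continuity by Borel-Cantelli\<close>

lemma positive_part_abs_continuous:
  fixes u :: "'a::euclidean_space \<Rightarrow> real" and \<epsilon> :: real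
  assumes b: "b \<in> Basis" and \<nu>: "vector_measure \<nu>" and u: "locally_integrable u"
    and parts: "\<And>\<phi>. test_function \<phi> \<Longrightarrow>
      integral\<^sup>L lebesgue (\<lambda>x. u x * frechet_derivative \<phi> (at x) b) = - signed_integral \<nu> \<phi>"
    and "\<epsilon> > 0"
  shows "\<exists>\<delta>>0. \<forall>B\<in>sets borel. hausdorff_measure (DIM('a) - 1) B < ennreal \<delta> \<longrightarrow>
    measure (positive_part \<nu>) B \<le> \<epsilon>"
proof (rule ccontr)
  let ?P = "positive_part \<nu>" and ?H = "hausdorff_measure (DIM('a) - 1)"
  interpret P: finite_measure ?P by (rule finite_measure_positive_part[OF \<nu>])
  assume *: "\<not> ?thesis"
  \<comment> \<open>Were the claim false, every \<open>\<delta>\<close> would have a counterexample;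
    the choice \<open>(1 / 2) ^ k\<close> makes the volumes of the covering cylinders summable after
    truncation.\<close>
  have "\<exists>B\<in>sets borel. ?H B < ennreal ((1 / 2) ^ k) \<and> measure ?P B > \<epsilon>" for k :: nat
  proof -
    have "(0::real) < (1 / 2) ^ k" by simp
    with * show ?thesis by (meson not_le)
  qed
  then obtain B where B: "\<And>k. B k \<in> sets borel" "\<And>k. ?H (B k) < ennreal ((1 / 2) ^ k)"
    "\<And>k. measure ?P (B k) > \<epsilon>"
    by metis
  define c where "c = 4 ^ (DIM('a) - 1) / unit_ball_vol (real (DIM('a) - 1))"
  have "c \<ge> 0" by (simp add: c_def less_imp_le)
  have "\<exists>T. T \<in> sets borel \<and> B k \<subseteq> drop_coord b -` T \<and>
    (\<forall>m\<ge>0. emeasure lborel (drop_coord b -` T \<inter> {x. \<bar>x \<bullet> b\<bar> \<le> m}) \<le> ennreal (2 * m * c * (1 / 2) ^ k))" for k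
    using hausdorff_measure_cylinder_cover[OF b B(2)] unfolding c_def by (metis times_divide_eq_right)
  then obtain T where T: "\<And>k. T k \<in> sets borel" "\<And>k. B k \<subseteq> drop_coord b -` T k"
    "\<And>k m. m \<ge> 0 \<Longrightarrow> emeasure lborel (drop_coord b -` T k \<inter> {x. \<bar>x \<bullet> b\<bar> \<le> m})
      \<le> ennreal (2 * m * c * (1 / 2) ^ k)"
    by metis
  define S where "S k = drop_coord b -` T k" for k
  have S [measurable]: "S k \<in> sets borel" for k
    unfolding S_def using measurable_sets[OF drop_coord_measurable T(1)] by simp
  \<comment> \<open>The limsup is taken among the cross sections, so that the limsup of the
    cylinders \<open>S k\<close> is visibly a cylinder over \<open>L\<close>.\<close>
  define L where "L = (\<Inter>n. \<Union>k\<in>{n..}. T k)"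
  have L: "L \<in> sets borel" unfolding L_def using T(1) by measurable
  have SL: "drop_coord b -` L = (\<Inter>n. \<Union>k\<in>{n..}. S k)"
    by (auto simp: L_def S_def)
  \<comment> \<open>The estimate controls only the truncated cylinders, so Borel-Cantelli is applied
    for each height \<open>m\<close>; countably many heights then exhaust the space.\<close>
  have null_m: "emeasure lborel (drop_coord b -` L \<inter> {x. \<bar>x \<bullet> b\<bar> \<le> m}) = 0" if m: "m \<ge> 0" for m
  proof -
    define E where "E k = S k \<inter> {x. \<bar>x \<bullet> b\<bar> \<le> m}" for k
    have E_le: "emeasure lborel (E k) \<le> ennreal (2 * m * c * (1 / 2) ^ k)" for k
      using T(3)[OF m] unfolding E_def S_def .
    have "limsup E \<in> null_sets lborel"
    proof (rule borel_cantelli_limsup1)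
      show "E n \<in> sets lborel" for n unfolding E_def by measurable
      show fin: "emeasure lborel (E n) < \<infinity>" for n
        using E_le[of n] by (auto intro: le_less_trans)
      show "summable (\<lambda>n. measure lborel (E n))"
      proof (rule summable_comparison_test')
        show "summable (\<lambda>k. 2 * m * c * (1 / 2) ^ k)"
          by (intro summable_mult summable_geometric) simp
        show "norm (measure lborel (E n)) \<le> 2 * m * c * (1 / 2) ^ n" for n
          using E_le[of n] m \<open>c \<ge> 0\<close> by (simp add: measure_def enn2real_leI)
      qed
    qed
    moreover have "limsup E = drop_coord b -` L \<inter> {x. \<bar>x \<bullet> b\<bar> \<le> m}"
      unfolding limsup_INF_SUP SL E_def by auto
    ultimately show ?thesis by (simp add: null_setsD1)
  qed
  have "emeasure lborel (drop_coord b -` L) = 0"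
  proof -
    have "drop_coord b -` L = (\<Union>n::nat. drop_coord b -` L \<inter> {x. \<bar>x \<bullet> b\<bar> \<le> real n})"
      using real_arch_simple by fastforce
    moreover have "(\<Union>n::nat. drop_coord b -` L \<inter> {x. \<bar>x \<bullet> b\<bar> \<le> real n}) \<in> null_sets lborel"
    proof (rule null_sets_UN)
      fix n :: nat
      have "drop_coord b -` L \<in> sets borel"
        using measurable_sets[OF drop_coord_measurable L] by simp
      moreover have "{x::'a. \<bar>x \<bullet> b\<bar> \<le> real n} \<in> sets borel" by measurable
      ultimately show "drop_coord b -` L \<inter> {x. \<bar>x \<bullet> b\<bar> \<le> real n} \<in> null_sets lborel"
        using null_m[of "real n"] by (intro null_setsI) auto
    qed
    ultimately show ?thesis by (simp add: null_setsD1)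
  qed
  then have "measure ?P (\<Inter>n. \<Union>k\<in>{n..}. S k) = 0"
    unfolding SL[symmetric] using measure_positive_part_null_cylinder[OF b \<nu> u parts L] by blast
  \<comment> \<open>Continuity from above, by finiteness of \<open>?P\<close>. Each tail union
    contains \<open>B n\<close> and so has measure at least \<open>\<epsilon>\<close>, against the
    null limit.\<close>
  moreover have "(\<lambda>n. measure ?P (\<Union>k\<in>{n..}. S k)) \<longlonglongrightarrow> measure ?P (\<Inter>n. \<Union>k\<in>{n..}. S k)"
  proof (rule P.finite_Lim_measure_decseq)
    show "decseq (\<lambda>n. \<Union>k\<in>{n..}. S k)"
      unfolding decseq_def by (intro allI impI UN_mono) auto
  qed auto
  moreover have "measure ?P (\<Union>k\<in>{n..}. S k) \<ge> \<epsilon>" for n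
  proof -
    have "\<epsilon> \<le> measure ?P (B n)" using B(3)[of n] by simp
    also have "\<dots> \<le> measure ?P (\<Union>k\<in>{n..}. S k)"
      using T(2)[of n] by (intro P.finite_measure_mono) (auto simp: S_def[symmetric])
    finally show ?thesis .
  qed
  ultimately have "\<epsilon> \<le> 0"
    by (metis LIMSEQ_le_const)
  with \<open>\<epsilon> > 0\<close> show False by simp
qed

lemma gradient_measure_abs_continuous:
  fixes u :: "'a::euclidean_space \<Rightarrow> real" and \<epsilon> :: real
  assumes u: "u \<in> BV_dot" and "\<epsilon> > 0"
  shows "\<exists>\<delta>>0. \<forall>B\<in>sets borel. hausdorff_measure (DIM('a) - 1) B < ennreal \<delta> \<longrightarrow>
    total_variation (gradient_measure u) B < ennreal \<epsilon>"
proof -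
  let ?H = "hausdorff_measure (DIM('a) - 1) :: 'a set \<Rightarrow> ennreal"
  define \<mu> where "\<mu> = gradient_measure u"
  have loc: "locally_integrable u" and "\<exists>\<mu>. has_gradient_measure u \<mu>"
    using u by (auto simp: BV_dot_def)
  then have "has_gradient_measure u \<mu>"
    unfolding \<mu>_def gradient_measure_def by (simp add: someI_ex[of "has_gradient_measure u"])
  then have \<mu>: "vector_measure \<mu>"
    and parts: "\<And>b \<phi>. b \<in> Basis \<Longrightarrow> test_function \<phi> \<Longrightarrow>
      integral\<^sup>L lebesgue (\<lambda>x. u x * frechet_derivative \<phi> (at x) b) = - signed_integral (\<lambda>A. \<mu> A \<bullet> b) \<phi>"
    by (auto simp: has_gradient_measure_def)
  let ?P = "\<lambda>b. positive_part (\<lambda>A. \<mu> A \<bullet> b)"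
  let ?N = "\<lambda>b. positive_part (\<lambda>A. - (\<mu> A \<bullet> b))"
  note P = vector_measure_inner[OF \<mu>]
  note N = vector_measure_uminus[OF P]
  have loc': "locally_integrable (\<lambda>x. - u x)"
    using loc by (simp add: locally_integrable_def set_integrable_def)
  \<comment> \<open>There are \<open>2 * DIM('a)\<close> parts to add, two per coordinate; with this
    \<open>\<eta>\<close> they total at most \<open>\<epsilon> / 2\<close>, which leaves the final
    inequality strict.\<close>
  define \<eta> where "\<eta> = \<epsilon> / (4 * DIM('a))"
  have "\<eta> > 0" using \<open>\<epsilon> > 0\<close> by (simp add: \<eta>_def)
  have "\<exists>\<delta>>0. \<forall>B\<in>sets borel. ?H B < ennreal \<delta> \<longrightarrow> measure (?P b) B \<le> \<eta> \<and> measure (?N b) B \<le> \<eta>"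
    if b: "b \<in> Basis" for b
  proof -
    obtain \<delta>1 where \<delta>1: "\<delta>1 > 0" "\<And>B. B \<in> sets borel \<Longrightarrow> ?H B < ennreal \<delta>1 \<Longrightarrow> measure (?P b) B \<le> \<eta>"
      using positive_part_abs_continuous[OF b P loc parts[OF b] \<open>\<eta> > 0\<close>] by blast
    \<comment> \<open>The negative part is treated as the positive part for \<open>- u\<close>:
      changing the sign of the measure swaps the two terms of
      \<open>signed_integral\<close>.\<close>
    have "integral\<^sup>L lebesgue (\<lambda>x. - u x * frechet_derivative \<phi> (at x) b)
        = - signed_integral (\<lambda>A. - (\<mu> A \<bullet> b)) \<phi>" if "test_function \<phi>" for \<phi>
      using parts[OF b that] by (simp add: signed_integral_def)
    from positive_part_abs_continuous[OF b N loc' this \<open>\<eta> > 0\<close>]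
    obtain \<delta>2 where \<delta>2: "\<delta>2 > 0" "\<And>B. B \<in> sets borel \<Longrightarrow> ?H B < ennreal \<delta>2 \<Longrightarrow> measure (?N b) B \<le> \<eta>"
      by blast
    have le: "ennreal (min \<delta>1 \<delta>2) \<le> ennreal \<delta>1" "ennreal (min \<delta>1 \<delta>2) \<le> ennreal \<delta>2"
      by (auto intro!: ennreal_leI)
    have "measure (?P b) B \<le> \<eta> \<and> measure (?N b) B \<le> \<eta>"
      if B: "B \<in> sets borel" and H: "?H B < ennreal (min \<delta>1 \<delta>2)" for B
      using \<delta>1(2)[OF B less_le_trans[OF H le(1)]] \<delta>2(2)[OF B less_le_trans[OF H le(2)]] ..
    moreover have "min \<delta>1 \<delta>2 > 0" using \<delta>1(1) \<delta>2(1) by simp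
    ultimately show ?thesis by blast
  qed
  then obtain \<delta> where \<delta>: "\<And>b. b \<in> Basis \<Longrightarrow> \<delta> b > 0"
    "\<And>b B. b \<in> Basis \<Longrightarrow> B \<in> sets borel \<Longrightarrow> ?H B < ennreal (\<delta> b) \<Longrightarrow>
      measure (?P b) B \<le> \<eta> \<and> measure (?N b) B \<le> \<eta>"
    by metis
  define \<delta>0 where "\<delta>0 = Min (\<delta> ` Basis)"
  have "\<delta>0 > 0" using \<delta>(1) by (simp add: \<delta>0_def)
  moreover have "total_variation \<mu> B < ennreal \<epsilon>"
    if B: "B \<in> sets borel" and H: "?H B < ennreal \<delta>0" for B
  proof -
    have "total_variation \<mu> B \<le> (\<Sum>b\<in>Basis. emeasure (?P b) B + emeasure (?N b) B)"
      by (rule total_variation_le[OF \<mu> B])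
    also have "\<dots> \<le> (\<Sum>b\<in>(Basis::'a set). ennreal (2 * \<eta>))"
    proof (rule sum_mono)
      fix b :: 'a assume b: "b \<in> Basis"
      interpret P: finite_measure "?P b" by (rule finite_measure_positive_part[OF P])
      interpret N: finite_measure "?N b" by (rule finite_measure_positive_part[OF N])
      have "ennreal \<delta>0 \<le> ennreal (\<delta> b)"
        using b by (intro ennreal_leI) (simp add: \<delta>0_def)
      then have *: "measure (?P b) B \<le> \<eta>" "measure (?N b) B \<le> \<eta>"
        using \<delta>(2)[OF b B] H by (auto intro: less_le_trans)
      have "emeasure (?P b) B + emeasure (?N b) B = ennreal (measure (?P b) B + measure (?N b) B)"
        by (simp add: P.emeasure_eq_measure N.emeasure_eq_measure)
      also have "\<dots> \<le> ennreal (2 * \<eta>)" using * by (intro ennreal_leI) simp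
      finally show "emeasure (?P b) B + emeasure (?N b) B \<le> ennreal (2 * \<eta>)" .
    qed
    also have "\<dots> = ennreal (DIM('a) * (2 * \<eta>))"
      using \<open>\<eta> > 0\<close> by (simp add: ennreal_mult ennreal_of_nat_eq_real_of_nat)
    also have "\<dots> < ennreal \<epsilon>"
      using \<open>\<epsilon> > 0\<close> by (intro ennreal_lessI) (auto simp: \<eta>_def)
    finally show ?thesis .
  qed
  ultimately show ?thesis unfolding \<mu>_def by blast
qed

theorem corollary1p6:
  fixes u :: "real ^ 'n \<Rightarrow> real"
  assumes "CARD('n) \<ge> 2"
    and "u \<in> BV_dot"
  shows "\<forall>\<epsilon>::real. \<epsilon> > 0 \<longrightarrow> (\<exists>\<delta>::real. \<delta> > 0 \<and>
           (\<forall>B\<in>sets borel. hausdorff_measure (CARD('n) - 1) B < ennreal \<delta> \<longrightarrow>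
              total_variation (gradient_measure u) B < ennreal \<epsilon>))"
  using gradient_measure_abs_continuous[OF assms(2)] by simp

end
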